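(* Let $0\le\sigma<\frac12$. Then there exists $\delta>0$ so that for any $q(0)\in\mathcal S(\mathbb{R})$ satisfying $\|q(0)\|_{L^2}\le\delta$, the solution $q(t)$ of either $i\frac{d}{dt}q=-q''\pm2|q|^2q$ or $\frac{d}{dt}q=-q'''\pm6|q|^2q'$ (either sign) satisfies $$\|q(t)'\|_{H^{\sigma-1}_\kappa}^2\lesssim\|q(0)'\|_{H^{\sigma-1}_\kappa}^2+\kappa^{2\sigma-1}\delta^2\|q(0)\|_{L^2}^2,$$ uniformly for $t\in\mathbb{R}$ and $\kappa\ge1$ (the implicit constant is independent of $t$, $\kappa$ and $q(0)$).
   Context: Functions are complex-valued on $\mathbb{R}$; primes denote $x$-derivatives; solutions are the global Schwartz-class solutions. For $\kappa\ge1$ and $\sigma\in\mathbb{R}$, $\|f\|_{H^\sigma_\kappa}^2:=\int(4\kappa^2+\xi^2)^\sigma|\hat f(\xi)|^2\,d\xi$. *)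

theory Defs
  imports "HOL-Analysis.Analysis"
begin

definition xderiv :: "(real \<Rightarrow> complex) \<Rightarrow> real \<Rightarrow> complex" where
  "xderiv f = (\<lambda>x. vector_derivative f (at x))"

definition schwartz :: "(real \<Rightarrow> complex) set" where
  "schwartz = {f. (\<forall>n x. (xderiv ^^ n) f differentiable (at x)) \<and>
                  (\<forall>k n. bounded (range (\<lambda>x. x ^ k *\<^sub>R (xderiv ^^ n) f x)))}"

text \<open>
  Differentiability of a curve at time \<open>t\<close> in the Frechet topology of the Schwartz space:
  the difference quotients converge to \<open>v\<close> in each of the seminorms
  \<open>sup\<^sub>x \<bar>x ^ k * f\<^bsup>(n)\<^esup> x\<bar>\<close>.
\<close>

definition has_schwartz_derivative ::
    "(real \<Rightarrow> real \<Rightarrow> complex) \<Rightarrow> (real \<Rightarrow> complex) \<Rightarrow> real \<Rightarrow> bool" where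
  "has_schwartz_derivative q v t \<longleftrightarrow>
     (\<forall>k n. uniform_limit UNIV
        (\<lambda>h x. x ^ k *\<^sub>R (xderiv ^^ n) (\<lambda>y. (q (t + h) y - q t y) /\<^sub>R h - v y) x)
        (\<lambda>x. 0) (at 0))"

text \<open>
  A curve \<open>q\<close>, defined for all times, in the Schwartz space with time derivative \<open>qt\<close>. For the
  two equations below \<open>qt t\<close> depends continuously on \<open>q t\<close>, so solutions are automatically
  continuously differentiable in time.
\<close>

definition schwartz_curve ::
    "(real \<Rightarrow> real \<Rightarrow> complex) \<Rightarrow> (real \<Rightarrow> real \<Rightarrow> complex) \<Rightarrow> bool" where
  "schwartz_curve q qt \<longleftrightarrow>
     (\<forall>t. q t \<in> schwartz \<and> qt t \<in> schwartz \<and> has_schwartz_derivative q (qt t) t)"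

text \<open>
  In both equations the real parameter \<open>s\<close> is the sign of the nonlinearity, to be taken
  in \<open>{1, -1}\<close>.
\<close>

definition nls_solution :: "real \<Rightarrow> (real \<Rightarrow> real \<Rightarrow> complex) \<Rightarrow> bool" where
  "nls_solution s q \<longleftrightarrow>
     (\<exists>qt. schwartz_curve q qt \<and>
        (\<forall>t x. \<i> * qt t x =
           - (xderiv ^^ 2) (q t) x
           + complex_of_real (s * 2 * (cmod (q t x))\<^sup>2) * q t x))"

definition mkdv_solution :: "real \<Rightarrow> (real \<Rightarrow> real \<Rightarrow> complex) \<Rightarrow> bool" where
  "mkdv_solution s q \<longleftrightarrow>
     (\<exists>qt. schwartz_curve q qt \<and>
        (\<forall>t x. qt t x =
           - (xderiv ^^ 3) (q t) x
           + complex_of_real (s * 6 * (cmod (q t x))\<^sup>2) * xderiv (q t) x))"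

text \<open>The unitary normalisation of the Fourier transform.\<close>

definition fourier :: "(real \<Rightarrow> complex) \<Rightarrow> real \<Rightarrow> complex" where
  "fourier f \<xi> = complex_of_real (1 / sqrt (2 * pi)) * (LINT x|lborel. cis (- (\<xi> * x)) * f x)"

text \<open>
  The integrals in the two norms below are Bochner integrals, which are 0 if the integrand is
  not integrable; for Schwartz functions the integrands are always integrable.
\<close>

definition L2norm :: "(real \<Rightarrow> complex) \<Rightarrow> real" where
  "L2norm f = sqrt (LINT x|lborel. (cmod (f x))\<^sup>2)"

definition Hnorm :: "real \<Rightarrow> real \<Rightarrow> (real \<Rightarrow> complex) \<Rightarrow> real" where
  "Hnorm \<kappa> \<sigma> f = sqrt (LINT \<xi>|lborel. (4 * \<kappa>\<^sup>2 + \<xi>\<^sup>2) powr \<sigma> * (cmod (fourier f \<xi>))\<^sup>2)"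

end

theory Submission
  imports Defs "HOL-Probability.Sinc_Integral" "HOL-Probability.Characteristic_Functions"
begin

text \<open>
  Put \<open>m = 2\<kappa>\<close> and \<open>r = s * cnj q\<close>, and let \<open>T g x = resolvent m g x\<close> be the integral of \<open>exp (- m (y - x)) * g y\<close>
  over \<open>y > x\<close>, so that \<open>(T g)' = m * T g - g\<close>. If \<open>q\<close> is small in \<open>L\<^sup>2\<close>, the Riccati equation
  \<open>u' = m u + r - q u\<^sup>2\<close> attached to the Zakharov-Shabat system has a small bounded solution
  \<open>u = T (q u\<^sup>2 - r)\<close>, and the integral of \<open>q u\<close> (the logarithm of the transmission coefficient) is
  conserved: the zero curvature representation gives both an explicit formula for the time
  derivative of \<open>u\<close> and a flux for the density \<open>q u\<close>. Since
  \<open>\<parallel>T q'\<parallel>\<^sup>2 = \<parallel>q\<parallel>\<^sup>2 - m * Re \<langle>q, T q\<rangle>\<close>, this integral and the \<open>L\<^sup>2\<close> norm together control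
  \<open>\<parallel>T q'\<parallel>\<^sup>2\<close>, which by Plancherel is the case \<open>\<sigma> = 0\<close> of the norm in question, up to an error
  of size \<open>\<parallel>q\<parallel>\<^sup>4 / m\<close>. The case \<open>\<sigma> > 0\<close> follows by integrating the case \<open>\<sigma> = 0\<close> against
  \<open>s powr (\<sigma> - 1)\<close> with \<open>4 \<kappa>\<^sup>2 + s\<close> in place of \<open>4 \<kappa>\<^sup>2\<close>, as
  \<open>(b + \<xi>\<^sup>2) powr (\<sigma> - 1)\<close> is a multiple of the integral of \<open>s powr (\<sigma> - 1) / (b + s + \<xi>\<^sup>2)\<close> over
  \<open>s > 0\<close>; the error term stays integrable because \<open>\<sigma> < 1 / 2\<close>.
\<close>

section \<open>Quadratically decaying functions\<close>

lemma integrable_inverse_1_plus_sq: "integrable lborel (\<lambda>x::real. 1 / (1 + x\<^sup>2))"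
proof -
  have "set_integrable lborel (einterval (-\<infinity>) \<infinity>) (\<lambda>x::real. inverse (1 + x^2))"
    by (rule integrable_inverse_1_plus_square)
  then show "integrable lborel (\<lambda>x::real. 1 / (1 + x\<^sup>2))"
    by (simp add: set_integrable_def inverse_eq_divide)
qed

text \<open>The working class in place of Schwartz functions: it is closed under multiplication by
  bounded continuous functions (such as Riccati solutions) and under \<open>resolvent m\<close>, and
  it still yields integrability, square integrability and vanishing at infinity.\<close>

definition quad_decay :: "(real \<Rightarrow> complex) \<Rightarrow> bool" where
  "quad_decay f \<longleftrightarrow> continuous_on UNIV f \<and> (\<exists>K. \<forall>x. cmod (f x) \<le> K / (1 + x\<^sup>2))"

lemma quad_decayE:
  assumes "quad_decay f"
  obtains K where "K \<ge> 0" "\<And>x. cmod (f x) \<le> K / (1 + x\<^sup>2)" "\<And>x. cmod (f x) \<le> K"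
proof -
  obtain K where K: "\<And>x. cmod (f x) \<le> K / (1 + x\<^sup>2)"
    using assms by (auto simp: quad_decay_def)
  from K[of 0] have "K \<ge> 0"
    using norm_ge_zero[of "f 0"] by (simp del: norm_ge_zero)
  moreover have "cmod (f x) \<le> K" for x
  proof -
    have "K / (1 + x\<^sup>2) \<le> K / 1"
      using \<open>K \<ge> 0\<close> by (intro divide_left_mono) (auto intro: add_pos_nonneg)
    with K[of x] show ?thesis by simp
  qed
  ultimately show ?thesis using K that by blast
qed

lemma quad_decay_continuous: "quad_decay f \<Longrightarrow> continuous_on UNIV f"
  by (simp add: quad_decay_def)

lemma quad_decay_measurable: "quad_decay f \<Longrightarrow> f \<in> borel_measurable borel"
  by (intro borel_measurable_continuous_onI quad_decay_continuous)

lemma quad_decay_integrable: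
  assumes "quad_decay f"
  shows "integrable lborel f"
proof -
  obtain K where "K \<ge> 0" "\<And>x. cmod (f x) \<le> K / (1 + x\<^sup>2)"
    using quad_decayE[OF assms] by metis
  then show ?thesis
    using quad_decay_measurable[OF assms]
    by (intro Bochner_Integration.integrable_bound[OF integrable_mult_right[OF integrable_inverse_1_plus_sq, of K]])
       (auto intro!: AE_I2)
qed

lemma quad_decay_tendsto:
  assumes "quad_decay f"
  shows "(f \<longlongrightarrow> 0) at_top" "(f \<longlongrightarrow> 0) at_bot"
proof -
  obtain K where K: "\<And>x. cmod (f x) \<le> K / (1 + x\<^sup>2)"
    using quad_decayE[OF assms] by metis
  have "((\<lambda>x::real. K / (1 + x\<^sup>2)) \<longlongrightarrow> 0) at_top" "((\<lambda>x::real. K / (1 + x\<^sup>2)) \<longlongrightarrow> 0) at_bot"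
    by (intro tendsto_divide_0[OF tendsto_const] filterlim_at_top_imp_at_infinity
          filterlim_tendsto_add_at_top[OF tendsto_const] filterlim_pow_at_top
          filterlim_pow_at_bot_even filterlim_ident; simp)+
  then show "(f \<longlongrightarrow> 0) at_top" "(f \<longlongrightarrow> 0) at_bot"
    by (auto intro: Lim_null_comparison[rotated] simp: K)
qed

lemma quad_decay_mult_bounded:
  assumes "quad_decay f" "continuous_on UNIV g" "\<And>x. cmod (g x) \<le> M"
  shows "quad_decay (\<lambda>x. f x * g x)"
proof -
  obtain K where K: "K \<ge> 0" "\<And>x. cmod (f x) \<le> K / (1 + x\<^sup>2)"
    using quad_decayE[OF assms(1)] by metis
  have "cmod (f x * g x) \<le> (K * M) / (1 + x\<^sup>2)" for x
    using mult_mono[OF K(2)[of x] assms(3)[of x]] K(1) by (auto simp: norm_mult)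
  then show ?thesis
    using assms by (auto simp: quad_decay_def intro!: continuous_intros)
qed

lemma quad_decay_mult:
  assumes "quad_decay f" "quad_decay g"
  shows "quad_decay (\<lambda>x. f x * g x)"
proof -
  obtain K where "\<And>x. cmod (g x) \<le> K"
    using quad_decayE[OF assms(2)] by metis
  then show ?thesis
    using assms by (intro quad_decay_mult_bounded) (auto simp: quad_decay_continuous)
qed

lemma quad_decay_scale: "quad_decay f \<Longrightarrow> quad_decay (\<lambda>x. c * f x)"
  using quad_decay_mult_bounded[of f "\<lambda>_. c" "cmod c"] by (simp add: mult.commute)

lemma quad_decay_minus: "quad_decay f \<Longrightarrow> quad_decay (\<lambda>x. - f x)"
  using quad_decay_scale[of f "-1"] by simp

lemma quad_decay_cnj: "quad_decay f \<Longrightarrow> quad_decay (\<lambda>x. cnj (f x))"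
  by (auto simp: quad_decay_def intro!: continuous_intros)

lemma quad_decay_add:
  assumes "quad_decay f" "quad_decay g"
  shows "quad_decay (\<lambda>x. f x + g x)"
proof -
  obtain K L where K: "\<And>x. cmod (f x) \<le> K / (1 + x\<^sup>2)" "\<And>x. cmod (g x) \<le> L / (1 + x\<^sup>2)"
    using assms by (metis quad_decayE)
  have "cmod (f x + g x) \<le> (K + L) / (1 + x\<^sup>2)" for x
    using norm_triangle_le[OF add_mono[OF K[of x]]] by (simp add: add_divide_distrib)
  then show ?thesis
    using assms by (auto simp: quad_decay_def intro!: continuous_intros)
qed

lemma quad_decay_diff: "quad_decay f \<Longrightarrow> quad_decay g \<Longrightarrow> quad_decay (\<lambda>x. f x - g x)"
  using quad_decay_add[of f "\<lambda>x. - g x"] quad_decay_minus[of g] by simp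

lemma quad_decay_integrable_sq:
  assumes "quad_decay f"
  shows "integrable lborel (\<lambda>x. (cmod (f x))\<^sup>2)"
proof -
  have "integrable lborel (\<lambda>x. f x * cnj (f x))"
    using assms by (intro quad_decay_integrable quad_decay_mult quad_decay_cnj)
  from integrable_norm[OF this] show ?thesis
    by (simp add: norm_mult power2_eq_square)
qed

lemma L2norm_sq: "(L2norm f)\<^sup>2 = (LINT x|lborel. (cmod (f x))\<^sup>2)"
  by (simp add: L2norm_def integral_nonneg_AE)

text \<open>The common form of the integrations by parts and conservation laws below. The flux
  \<open>F\<close> only has to vanish at both ends; the quadratic decay is asked of its
  derivative.\<close>

lemma integral_of_derivative_eq_0:
  fixes F :: "real \<Rightarrow> complex"
  assumes "\<And>x. (F has_vector_derivative f x) (at x)" "quad_decay f"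
    and "(F \<longlongrightarrow> 0) at_top" "(F \<longlongrightarrow> 0) at_bot"
  shows "(LINT x|lborel. f x) = 0"
proof -
  have "(LBINT x=-\<infinity>..\<infinity>. f x) = 0 - 0"
  proof (rule interval_integral_FTC_integrable)
    show "set_integrable lborel (einterval (-\<infinity>) \<infinity>) f"
      using quad_decay_integrable[OF assms(2)] by (simp add: set_integrable_def)
    show "isCont f x" for x
      using quad_decay_continuous[OF assms(2)] by (simp add: continuous_on_eq_continuous_at)
    show "((F \<circ> real_of_ereal) \<longlongrightarrow> 0) (at_right (- \<infinity>))"
      using assms(4) by (simp add: ereal_tendsto_simps)
    show "((F \<circ> real_of_ereal) \<longlongrightarrow> 0) (at_left \<infinity>)"
      using assms(3) by (simp add: ereal_tendsto_simps)
  qed (use assms in auto)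
  then show ?thesis
    by (simp add: interval_lebesgue_integral_def set_lebesgue_integral_def)
qed

section \<open>Schwartz functions and their derivatives\<close>

lemma schwartz_has_derivative:
  assumes "f \<in> schwartz"
  shows "((xderiv ^^ n) f has_vector_derivative (xderiv ^^ Suc n) f x) (at x)"
  using assms vector_derivative_works[of "(xderiv ^^ n) f" "at x"]
  by (simp add: schwartz_def xderiv_def)

lemma schwartz_quad_decay:
  assumes "f \<in> schwartz"
  shows "quad_decay ((xderiv ^^ n) f)"
proof -
  have "continuous_on UNIV ((xderiv ^^ n) f)"
    using schwartz_has_derivative[OF assms]
    by (meson continuous_at_imp_continuous_on has_vector_derivative_continuous)
  moreover obtain K where K: "\<And>x. cmod (x ^ 0 *\<^sub>R (xderiv ^^ n) f x) \<le> K"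
    using assms unfolding schwartz_def bounded_iff by blast
  moreover obtain L where L: "\<And>x. cmod (x ^ 2 *\<^sub>R (xderiv ^^ n) f x) \<le> L"
    using assms unfolding schwartz_def bounded_iff by blast
  have "cmod ((xderiv ^^ n) f x) \<le> (K + L) / (1 + x\<^sup>2)" for x
  proof -
    have "cmod ((xderiv ^^ n) f x) * (1 + x\<^sup>2) \<le> K + L"
      using K[of x] L[of x] by (simp add: algebra_simps)
    moreover have "1 + x\<^sup>2 > 0" by (simp add: add_pos_nonneg)
    ultimately show ?thesis by (simp add: pos_le_divide_eq)
  qed
  ultimately show ?thesis by (auto simp: quad_decay_def)
qed

section \<open>The resolvent of the derivative\<close>

text \<open>The inverse of \<open>m - d/dx\<close>, that is, the Fourier multiplier 1 / (m - i
  \<xi>). For m > 0 the integral runs over y > x because the kernel decays there; this selects the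
  bounded solution among those differing by a multiple of exp (m x).\<close>

definition resolvent :: "real \<Rightarrow> (real \<Rightarrow> complex) \<Rightarrow> real \<Rightarrow> complex" where
  "resolvent m g x = (LBINT y=ereal x..\<infinity>. exp (- (m * (y - x))) *\<^sub>R g y)"

lemma exp_kernel_integral:
  fixes m x :: real
  assumes "m > 0"
  shows "set_integrable lborel {x<..} (\<lambda>y. exp (- (m * (y - x))))"
    and "(LINT y:{x<..}|lborel. exp (- (m * (y - x)))) = 1 / m"
proof -
  let ?F = "\<lambda>y. - (exp (- (m * (y - x))) / m)"
  have 1: "(?F has_real_derivative exp (- (m * (y - x)))) (at y)" for y
    using assms by (auto intro!: derivative_eq_intros)
  have 2: "((?F \<circ> real_of_ereal) \<longlongrightarrow> - (1 / m)) (at_right (ereal x))"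
  proof -
    have "isCont ?F x" using DERIV_isCont[OF 1] .
    then have "(?F \<longlongrightarrow> ?F x) (at_right x)"
      by (simp add: isCont_def filterlim_at_split)
    then show ?thesis by (simp add: ereal_tendsto_simps)
  qed
  have 3: "((?F \<circ> real_of_ereal) \<longlongrightarrow> 0) (at_left \<infinity>)"
  proof -
    have "filterlim (\<lambda>y. - x + y) at_top at_top"
      by (intro filterlim_tendsto_add_at_top[OF tendsto_const] filterlim_ident)
    then have "filterlim (\<lambda>y. m * (y - x)) at_top at_top"
      by (intro filterlim_tendsto_pos_mult_at_top[OF tendsto_const assms]) simp
    then have "filterlim (\<lambda>y. - (m * (y - x))) at_bot at_top"
      by (simp add: filterlim_uminus_at_top)
    from filterlim_compose[OF exp_at_bot this]
    have "((\<lambda>y. exp (- (m * (y - x)))) \<longlongrightarrow> 0) at_top" .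
    then have "(?F \<longlongrightarrow> - (0 / m)) at_top"
      using assms by (intro tendsto_intros) auto
    then show ?thesis by (simp add: ereal_tendsto_simps)
  qed
  have "set_integrable lborel (einterval (ereal x) \<infinity>) (\<lambda>y. exp (- (m * (y - x))))"
    by (rule interval_integral_FTC_nonneg(1)[OF _ _ _ _ 2 3]) (use 1 in \<open>auto intro!: continuous_intros\<close>)
  then show "set_integrable lborel {x<..} (\<lambda>y. exp (- (m * (y - x))))" by simp
  have "(LBINT y=ereal x..\<infinity>. exp (- (m * (y - x)))) = 0 - (- (1 / m))"
    by (rule interval_integral_FTC_nonneg(2)[OF _ _ _ _ 2 3]) (use 1 in \<open>auto intro!: continuous_intros\<close>)
  then show "(LINT y:{x<..}|lborel. exp (- (m * (y - x)))) = 1 / m"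
    by (simp add: interval_integral_to_infinity_eq)
qed

text \<open>The bounds on the resolvent in terms of the supremum, the L2 norm and quadratic decay
  all come from this comparison by a suitable choice of the majorant \<open>h\<close>.\<close>

lemma norm_resolvent_le:
  assumes "m > 0" "continuous_on UNIV g"
    and "\<And>y. y > x \<Longrightarrow> exp (- (m * (y - x))) * cmod (g y) \<le> h y"
    and "set_integrable lborel {x<..} h"
  shows "set_integrable lborel {x<..} (\<lambda>y. exp (- (m * (y - x))) *\<^sub>R g y)"
    and "cmod (resolvent m g x) \<le> (LINT y:{x<..}|lborel. h y)"
proof -
  show 1: "set_integrable lborel {x<..} (\<lambda>y. exp (- (m * (y - x))) *\<^sub>R g y)"
  proof (rule set_integrable_bound[OF assms(4)])
    have "(\<lambda>y. exp (- (m * (y - x))) *\<^sub>R g y) \<in> borel_measurable borel"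
      using assms(2) by (intro borel_measurable_continuous_onI continuous_intros)
    then show "set_borel_measurable lborel {x<..} (\<lambda>y. exp (- (m * (y - x))) *\<^sub>R g y)"
      unfolding set_borel_measurable_def
      using borel_measurable_continuous_onI[OF assms(2)] by (intro borel_measurable_scaleR) simp_all
  qed (use assms(3) in \<open>auto intro!: AE_I2 simp: order_trans[OF _ abs_ge_self]\<close>)
  have "cmod (resolvent m g x) \<le> (LINT y:{x<..}|lborel. cmod (exp (- (m * (y - x))) *\<^sub>R g y))"
    unfolding resolvent_def interval_integral_to_infinity_eq
    by (rule set_integral_norm_bound[OF 1])
  also have "\<dots> \<le> (LINT y:{x<..}|lborel. h y)"
    using assms(3) by (intro set_integral_mono set_integrable_norm 1 assms(4)) auto
  finally show "cmod (resolvent m g x) \<le> (LINT y:{x<..}|lborel. h y)" .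
qed

lemma resolvent_integrable:
  assumes "m > 0" "continuous_on UNIV g" "\<And>y. cmod (g y) \<le> M"
  shows "set_integrable lborel {x<..} (\<lambda>y. exp (- (m * (y - x))) *\<^sub>R g y)"
    and resolvent_bound_sup: "cmod (resolvent m g x) \<le> M / m"
proof -
  have h: "set_integrable lborel {x<..} (\<lambda>y. exp (- (m * (y - x))) * M)"
    using exp_kernel_integral(1)[OF assms(1)] by simp
  note * = norm_resolvent_le[OF assms(1,2) _ h]
  show "set_integrable lborel {x<..} (\<lambda>y. exp (- (m * (y - x))) *\<^sub>R g y)"
    using assms(3) by (intro *(1)) auto
  show "cmod (resolvent m g x) \<le> M / m"
    using *(2) assms(3) exp_kernel_integral(2)[OF assms(1), of x] by simp
qed

text \<open>AM-GM with weight \<open>l\<close>, optimised at \<open>l = L2norm q * sqrt (2 * m)\<close>, replaces Cauchy-Schwarz.\<close>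

lemma resolvent_bound_L2:
  assumes "m > 0" "quad_decay q" "continuous_on UNIV g" "\<And>y. cmod (g y) \<le> M * cmod (q y)" "M \<ge> 0"
  shows "cmod (resolvent m g x) \<le> M * (L2norm q / sqrt (2 * m))"
proof -
  define N where "N = L2norm q"
  have N: "N \<ge> 0" "N\<^sup>2 = (LINT x|lborel. (cmod (q x))\<^sup>2)"
    by (simp_all add: N_def L2norm_sq) (simp add: L2norm_def integral_nonneg_AE)
  have *: "cmod (resolvent m g x) \<le> M * ((l / (2 * m) + N\<^sup>2 / l) / 2)" if l: "l > 0" for l
  proof -
    define h where "h = (\<lambda>y. (M * l / 2) * exp (- ((2 * m) * (y - x))) + (M / (2 * l)) * (cmod (q y))\<^sup>2)"
    have i1: "set_integrable lborel {x<..} (\<lambda>y. exp (- ((2 * m) * (y - x))))"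
      by (rule exp_kernel_integral(1)) (use assms in auto)
    have i2: "set_integrable lborel {x<..} (\<lambda>y. (cmod (q y))\<^sup>2)"
      unfolding set_integrable_def
      by (intro integrable_mult_indicator quad_decay_integrable_sq assms) auto
    have h: "set_integrable lborel {x<..} h"
      unfolding h_def using i1 i2 by (intro set_integral_add set_integrable_mult_right) auto
    have "exp (- (m * (y - x))) * cmod (g y) \<le> h y" for y
    proof -
      define e where "e = exp (- (m * (y - x)))"
      have e2: "exp (- ((2 * m) * (y - x))) = e\<^sup>2"
        by (simp add: e_def power2_eq_square flip: exp_add)
      have "0 \<le> (l * e - cmod (q y))\<^sup>2" by simp
      then have "2 * (l * (e * cmod (q y))) \<le> l * (l * e\<^sup>2) + (cmod (q y))\<^sup>2"
        by (simp add: power2_eq_square algebra_simps)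
      then have "e * cmod (q y) \<le> (l / 2) * e\<^sup>2 + (1 / (2 * l)) * (cmod (q y))\<^sup>2"
        using l by (simp add: field_simps power2_eq_square)
      then have "M * (e * cmod (q y)) \<le> M * ((l / 2) * e\<^sup>2 + (1 / (2 * l)) * (cmod (q y))\<^sup>2)"
        using assms(5) by (intro mult_left_mono)
      moreover have "e * cmod (g y) \<le> e * (M * cmod (q y))"
        using assms(4) by (intro mult_left_mono) (auto simp: e_def)
      ultimately show ?thesis
        unfolding h_def e2 e_def[symmetric] by (simp add: algebra_simps)
    qed
    from norm_resolvent_le(2)[OF assms(1,3) this h]
    have "cmod (resolvent m g x) \<le> (LINT y:{x<..}|lborel. h y)" .
    also have "\<dots> = (M * l / 2) * (1 / (2 * m)) + (M / (2 * l)) * (LINT y:{x<..}|lborel. (cmod (q y))\<^sup>2)"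
      unfolding h_def using i1 i2 exp_kernel_integral(2)[of "2 * m" x] assms(1)
      by (subst set_integral_add) auto
    also have "(LINT y:{x<..}|lborel. (cmod (q y))\<^sup>2) \<le> N\<^sup>2"
      unfolding N set_lebesgue_integral_def using i2 unfolding set_integrable_def
      by (intro integral_mono quad_decay_integrable_sq assms) (auto simp: indicator_def)
    finally show ?thesis
      using assms(1,5) l by (simp add: mult_left_mono divide_right_mono) (simp add: field_simps)
  qed
  show ?thesis
  proof (cases "N = 0")
    case True
    \<comment> \<open>The optimal weight would be 0 here, so \<open>l\<close> is a small positive
      number instead: \<open>*\<close> then bounds the resolvent by a multiple of \<open>l\<close>,
      and this \<open>l\<close> makes the bound at most \<open>e\<close>. The denominator
      \<open>M + 1\<close> avoids a division by zero.\<close>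
    have "cmod (resolvent m g x) \<le> 0 + e" if "e > 0" for e
    proof -
      have "cmod (resolvent m g x) \<le> M * ((e / (M + 1) * (4 * m)) / (2 * m) / 2)"
        using *[of "e / (M + 1) * (4 * m)"] that assms True by simp
      also have "\<dots> = e * (M / (M + 1))"
        using assms(1,5) by (simp add: divide_simps)
      also have "\<dots> \<le> e * 1"
        using assms that by (intro mult_left_mono) auto
      finally show ?thesis by simp
    qed
    then have "cmod (resolvent m g x) \<le> 0" by (rule field_le_epsilon)
    then show ?thesis using True by (simp add: N_def)
  next
    case False
    define r where "r = sqrt (2 * m)"
    have r: "r > 0" "2 * m = r * r" using assms by (auto simp: r_def)
    have "cmod (resolvent m g x) \<le> M * (((N * r) / (2 * m) + N\<^sup>2 / (N * r)) / 2)"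
      using *[of "N * r"] N False r by simp
    also have "\<dots> = M * (N / r)"
      unfolding r(2) using r(1) False by (simp add: field_simps power2_eq_square)
    finally show ?thesis by (simp add: N_def r_def)
  qed
qed

text \<open>Peetre's inequality for the weight \<open>1 + x\<^sup>2\<close>: the weight moves from
  \<open>y\<close> to \<open>x\<close> at the cost of the weight of \<open>y - x\<close>. The
  difference of the two sides is a sum of squares.\<close>

lemma quad_weight_shift: "1 + x\<^sup>2 \<le> 2 * (1 + (y - x)\<^sup>2) * (1 + y\<^sup>2)" for x y :: real
proof -
  have "2 * (1 + (y - x)\<^sup>2) * (1 + y\<^sup>2) - (1 + x\<^sup>2) = (2 * y - x)\<^sup>2 + 1 + 2 * ((y - x) * y)\<^sup>2"
    by (simp add: power2_eq_square algebra_simps)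
  moreover have "\<dots> \<ge> 0" by (simp add: add_nonneg_nonneg)
  ultimately show ?thesis by linarith
qed

text \<open>The kernel is split as exp (-z) * exp (-z) with z = m (y - x) / 2. One factor absorbs
  the weight of y - x produced by \<open>quad_weight_shift\<close>, since
  \<open>z\<^sup>2 / 2\<close> is at most exp z; this gives the 8 in the constant. The other factor
  is integrated.\<close>

lemma resolvent_bound_quad:
  assumes "m > 0" "continuous_on UNIV g" "\<And>y. cmod (g y) \<le> K / (1 + y\<^sup>2)" "K \<ge> 0"
  shows "cmod (resolvent m g x) \<le> (4 * K * (1 + 8 / m\<^sup>2) / m) / (1 + x\<^sup>2)"
proof -
  define B where "B = 1 + 8 / m\<^sup>2"
  define h where "h = (\<lambda>y. (2 * K * B / (1 + x\<^sup>2)) * exp (- (m / 2 * (y - x))))"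
  have px: "1 + x\<^sup>2 > 0" for x :: real by (simp add: add_pos_nonneg)
  have h: "set_integrable lborel {x<..} h"
    unfolding h_def using exp_kernel_integral(1)[of "m / 2" x] assms by (intro set_integrable_mult_right) auto
  have "exp (- (m * (y - x))) * cmod (g y) \<le> h y" if "y > x" for y
  proof -
    define z where "z = m / 2 * (y - x)"
    have z: "z \<ge> 0" using that assms by (simp add: z_def)
    have e: "exp (- (m * (y - x))) = exp (- z) * exp (- z)"
      by (simp add: z_def flip: exp_add)
    have "(y - x)\<^sup>2 = 8 / m\<^sup>2 * (z\<^sup>2 / 2)"
      using assms(1) by (simp add: z_def field_simps power2_eq_square)
    also have "\<dots> \<le> 8 / m\<^sup>2 * exp z"
      using exp_lower_Taylor_quadratic[OF z] z by (intro mult_left_mono) auto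
    finally have "1 + (y - x)\<^sup>2 \<le> B * exp z"
      using one_le_exp_iff[THEN iffD2, OF z] unfolding B_def distrib_right by linarith
    then have "exp (- z) * (1 + (y - x)\<^sup>2) \<le> exp (- z) * (B * exp z)"
      by (intro mult_left_mono) auto
    also have "\<dots> = B" by (simp add: exp_minus)
    finally have b: "exp (- z) * (1 + (y - x)\<^sup>2) \<le> B" .
    have "cmod (g y) \<le> K / (1 + y\<^sup>2)" by (rule assms)
    also have "\<dots> \<le> K * (2 * (1 + (y - x)\<^sup>2) / (1 + x\<^sup>2))"
    proof -
      have "1 / (1 + y\<^sup>2) \<le> 2 * (1 + (y - x)\<^sup>2) / (1 + x\<^sup>2)"
        using quad_weight_shift[of x y] px[of x] px[of y] by (simp add: pos_divide_le_eq pos_le_divide_eq)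
      from mult_left_mono[OF this assms(4)] show ?thesis by simp
    qed
    finally have "exp (- (m * (y - x))) * cmod (g y) \<le> exp (- z) * exp (- z) * (K * (2 * (1 + (y - x)\<^sup>2) / (1 + x\<^sup>2)))"
      unfolding e by (intro mult_left_mono) auto
    also have "\<dots> = exp (- z) * (2 * K / (1 + x\<^sup>2)) * (exp (- z) * (1 + (y - x)\<^sup>2))"
      by (simp add: field_simps)
    also have "\<dots> \<le> exp (- z) * (2 * K / (1 + x\<^sup>2)) * B"
      using b assms px[of x] by (intro mult_left_mono) auto
    finally show ?thesis by (simp add: h_def z_def algebra_simps)
  qed
  from norm_resolvent_le(2)[OF assms(1,2) this h]
  show ?thesis
    using exp_kernel_integral(2)[of "m / 2" x] assms(1) by (simp add: h_def B_def mult_ac)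
qed

text \<open>Factoring exp (m z) out of the kernel leaves a tail integral whose integrand is
  independent of \<open>z\<close>. Near \<open>x\<close> the tail is a constant minus an integral
  from the fixed base point \<open>a\<close>, to which the fundamental theorem applies.\<close>

lemma resolvent_has_derivative:
  assumes "m > 0" "continuous_on UNIV g" "\<And>y. cmod (g y) \<le> M"
  shows "(resolvent m g has_vector_derivative (m *\<^sub>R resolvent m g x - g x)) (at x)"
proof -
  define f where "f = (\<lambda>y. exp (- (m * y)) *\<^sub>R g y)"
  define a where "a = x - 1"
  have cf: "continuous_on S f" for S
    unfolding f_def by (intro continuous_intros continuous_on_subset[OF assms(2)]) auto
  have fi: "set_integrable lborel {z<..} f" for z
  proof -
    have "set_integrable lborel {z<..} (\<lambda>y. exp (- (m * z)) *\<^sub>R (exp (- (m * (y - z))) *\<^sub>R g y))"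
      by (intro set_integrable_scaleR_right resolvent_integrable[OF assms])
    then show ?thesis by (simp add: f_def algebra_simps flip: exp_add)
  qed
  have R: "resolvent m g z = exp (m * z) *\<^sub>R (LBINT y=z..\<infinity>. f y)" for z
    unfolding resolvent_def f_def interval_integral_to_infinity_eq
    by (subst set_integral_scaleR_right[symmetric]) (simp add: algebra_simps flip: exp_add)
  have split: "(LBINT y=z..\<infinity>. f y) = (LBINT y=a..\<infinity>. f y) - (LBINT y=a..z. f y)" if "z > a" for z
  proof -
    have "(LBINT y=a..z. f y) + (LBINT y=z..\<infinity>. f y) = (LBINT y=a..\<infinity>. f y)"
      by (rule interval_integral_sum) (use fi[of a] that in \<open>simp add: interval_integrable_to_infinity_eq\<close>)
    then show ?thesis by (simp add: algebra_simps)
  qed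
  have "((\<lambda>u. LBINT y=a..u. f y) has_vector_derivative f x) (at x within {a..x+1})"
    by (rule interval_integral_FTC2) (auto simp: a_def cf)
  then have D: "((\<lambda>u. LBINT y=a..u. f y) has_vector_derivative f x) (at x)"
    by (simp add: at_within_Icc_at a_def)
  have fx: "f x = exp (- (m * x)) *\<^sub>R g x" by (simp add: f_def)
  have Rx: "(LBINT y=a..\<infinity>. f y) - (LBINT y=a..x. f y) = exp (- (m * x)) *\<^sub>R resolvent m g x"
    using split[of x] by (simp add: R a_def flip: exp_add)
  have "((\<lambda>z. exp (m * z) *\<^sub>R ((LBINT y=a..\<infinity>. f y) - (LBINT y=a..z. f y)))
      has_vector_derivative (m *\<^sub>R resolvent m g x - g x)) (at x)"
    by (rule derivative_eq_intros D refl)+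
       (simp add: Rx fx mult.assoc flip: exp_add)
  then show ?thesis
    by (rule has_vector_derivative_transform_within_open[of _ _ _ "{a<..}"]) (auto simp: a_def R split)
qed

text \<open>Uniqueness of bounded solutions. The derivative of exp (- m (y - x)) f(y) in
  \<open>y\<close> is the negative of the resolvent integrand; boundedness of \<open>f\<close> kills
  the boundary term at infinity, and the one at \<open>x\<close> is f(x).\<close>

lemma eq_resolvent:
  assumes "m > 0" "\<And>x. (f has_vector_derivative (m *\<^sub>R f x - g x)) (at x)"
    and "continuous_on UNIV g" "\<And>y. cmod (g y) \<le> M" "\<And>y. cmod (f y) \<le> L"
  shows "f x = resolvent m g x"
proof -
  let ?F = "\<lambda>y. exp (- (m * (y - x))) *\<^sub>R f y"
  have "(LBINT y=ereal x..\<infinity>. - (exp (- (m * (y - x))) *\<^sub>R g y)) = 0 - f x"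
  proof (rule interval_integral_FTC_integrable)
    show "(?F has_vector_derivative - (exp (- (m * (y - x))) *\<^sub>R g y)) (at y)" for y
      by (rule derivative_eq_intros assms(2) refl)+ (simp add: algebra_simps)
    show "isCont (\<lambda>y. - (exp (- (m * (y - x))) *\<^sub>R g y)) y" for y
      using assms(3) by (intro continuous_intros) (simp add: continuous_on_eq_continuous_at)
    show "set_integrable lborel (einterval (ereal x) \<infinity>) (\<lambda>y. - (exp (- (m * (y - x))) *\<^sub>R g y))"
      using resolvent_integrable[OF assms(1,3,4), of x]
      by (simp add: set_integrable_def)
    show "((?F \<circ> real_of_ereal) \<longlongrightarrow> f x) (at_right (ereal x))"
    proof -
      have "isCont f x"
        using assms(2) has_vector_derivative_continuous by blast
      then have "isCont ?F x" by (intro continuous_intros)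
      then have "(?F \<longlongrightarrow> ?F x) (at_right x)"
        by (simp add: isCont_def filterlim_at_split)
      then show ?thesis by (simp add: ereal_tendsto_simps)
    qed
    show "((?F \<circ> real_of_ereal) \<longlongrightarrow> 0) (at_left \<infinity>)"
    proof -
      have "filterlim (\<lambda>y. - x + y) at_top at_top"
        by (intro filterlim_tendsto_add_at_top[OF tendsto_const] filterlim_ident)
      then have "filterlim (\<lambda>y. m * (y - x)) at_top at_top"
        by (intro filterlim_tendsto_pos_mult_at_top[OF tendsto_const assms(1)]) simp
      then have "filterlim (\<lambda>y. - (m * (y - x))) at_bot at_top"
        by (simp add: filterlim_uminus_at_top)
      from filterlim_compose[OF exp_at_bot this]
      have "((\<lambda>y. exp (- (m * (y - x)))) \<longlongrightarrow> 0) at_top" .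
      then have "((\<lambda>y. exp (- (m * (y - x))) * L) \<longlongrightarrow> 0) at_top"
        by (rule tendsto_mult_left_zero)
      then have "(?F \<longlongrightarrow> 0) at_top"
        by (rule Lim_null_comparison[rotated]) (simp add: assms(5))
      then show ?thesis by (simp add: ereal_tendsto_simps)
    qed
  qed simp
  then have "- (LBINT y=ereal x..\<infinity>. exp (- (m * (y - x))) *\<^sub>R g y) = - f x"
    by (simp add: interval_lebesgue_integral_uminus)
  then show ?thesis by (simp add: resolvent_def)
qed

section \<open>The Riccati equation\<close>

lemma resolvent_bounded:
  assumes "m > 0" "continuous_on UNIV g" "bounded (range g)"
  shows "continuous_on UNIV (resolvent m g)" "bounded (range (resolvent m g))"
proof -
  obtain M where M: "\<And>y. cmod (g y) \<le> M"
    using assms(3) by (auto simp: bounded_iff)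
  show "continuous_on UNIV (resolvent m g)"
    using resolvent_has_derivative[OF assms(1,2) M]
    by (meson continuous_at_imp_continuous_on has_vector_derivative_continuous)
  show "bounded (range (resolvent m g))"
    using resolvent_bound_sup[OF assms(1,2) M] by (auto simp: bounded_iff)
qed

lemma resolvent_add:
  assumes "m > 0" "continuous_on UNIV f" "bounded (range f)" "continuous_on UNIV g" "bounded (range g)"
  shows "resolvent m f x + resolvent m g x = resolvent m (\<lambda>y. f y + g y) x"
proof -
  obtain M L where M: "\<And>y. cmod (f y) \<le> M" "\<And>y. cmod (g y) \<le> L"
    using assms(3,5) by (auto simp: bounded_iff)
  have "set_integrable lborel {x<..} (\<lambda>y. exp (- (m * (y - x))) *\<^sub>R f y)"
    "set_integrable lborel {x<..} (\<lambda>y. exp (- (m * (y - x))) *\<^sub>R g y)"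
    using resolvent_integrable[OF assms(1,2) M(1)] resolvent_integrable[OF assms(1,4) M(2)] by auto
  from set_integral_add(2)[OF this] show ?thesis
    by (simp add: resolvent_def interval_integral_to_infinity_eq scaleR_add_right)
qed

lemma resolvent_diff:
  assumes "m > 0" "continuous_on UNIV f" "bounded (range f)" "continuous_on UNIV g" "bounded (range g)"
  shows "resolvent m f x - resolvent m g x = resolvent m (\<lambda>y. f y - g y) x"
  using resolvent_add[of m "\<lambda>y. f y - g y" g x] assms
  by (simp add: continuous_on_diff bounded_minus_comp algebra_simps)

text \<open>Banach's fixed point theorem for
  \<open>u \<mapsto> resolvent m (q * u\<^sup>2 - r)\<close> on the ball of radius 2 c in the
  bounded continuous functions. By the L2 bound on the resolvent the image has norm at most ((2 c)^2
  + 1) c, hence at most 2 c, and the Lipschitz constant is 4 c * c, hence at most 1/4.\<close>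

lemma riccati_solution:
  fixes q r :: "real \<Rightarrow> complex"
  assumes "m > 0" "quad_decay q" "quad_decay r" "\<And>x. cmod (r x) \<le> cmod (q x)"
    and c: "c = L2norm q / sqrt (2 * m)" "c \<le> 1 / 4"
  obtains u where "\<And>x. (u has_vector_derivative (m *\<^sub>R u x - (q x * (u x)\<^sup>2 - r x))) (at x)"
    "\<And>x. cmod (u x) \<le> 2 * c"
proof -
  define G where "G = (\<lambda>(u :: real \<Rightarrow> complex) y. q y * (u y)\<^sup>2 - r y)"
  define \<Phi> where "\<Phi> = (\<lambda>u :: real \<Rightarrow>\<^sub>C complex. Bcontfun (resolvent m (G u)))"
  have c0: "c \<ge> 0" unfolding c L2norm_def using assms(1) by (simp add: integral_nonneg_AE)
  have cont: "continuous_on UNIV q" "continuous_on UNIV r"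
    using assms by (auto simp: quad_decay_continuous)
  have Gc: "continuous_on UNIV (G u)" for u :: "real \<Rightarrow>\<^sub>C complex"
    unfolding G_def by (intro continuous_intros cont) auto
  have Gq: "cmod (G u y) \<le> (M\<^sup>2 + 1) * cmod (q y)" if "cmod (u y) \<le> M" for u y M
  proof -
    have "cmod (G u y) \<le> cmod (q y) * (cmod (u y))\<^sup>2 + cmod (r y)"
      unfolding G_def by (rule order_trans[OF norm_triangle_ineq4]) (simp add: norm_mult norm_power)
    also have "\<dots> \<le> cmod (q y) * M\<^sup>2 + cmod (q y)"
      using that assms(4) by (intro add_mono mult_left_mono power_mono) auto
    finally show ?thesis by (simp add: algebra_simps)
  qed
  obtain K where K: "\<And>x. cmod (q x) \<le> K" using quad_decayE[OF assms(2)] by metis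
  have Gb: "bounded (range (G u))" for u :: "real \<Rightarrow>\<^sub>C complex"
  proof -
    have "cmod (G u y) \<le> ((norm u)\<^sup>2 + 1) * K" for y
      using order_trans[OF Gq[OF norm_bounded] mult_left_mono[OF K]] by simp
    then show ?thesis by (auto simp: bounded_iff)
  qed
  have \<Phi>: "apply_bcontfun (\<Phi> u) = resolvent m (G u)" for u
    unfolding \<Phi>_def
    by (rule Bcontfun_inverse) (use resolvent_bounded[OF assms(1) Gc Gb] in \<open>auto simp: bcontfun_def\<close>)
  have "\<exists>!u. u \<in> cball 0 (2 * c) \<and> \<Phi> u = u"
  proof (rule Banach_fix[of _ "1 / 4"])
    show "\<Phi> ` cball 0 (2 * c) \<subseteq> cball 0 (2 * c)"
    proof safe
      fix u :: "real \<Rightarrow>\<^sub>C complex" assume u: "u \<in> cball 0 (2 * c)"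
      have "cmod (\<Phi> u x) \<le> 2 * c" for x
      proof -
        have "cmod (resolvent m (G u) x) \<le> ((2 * c)\<^sup>2 + 1) * (L2norm q / sqrt (2 * m))"
        proof (rule resolvent_bound_L2[OF assms(1,2) Gc])
          show "cmod (G u y) \<le> ((2 * c)\<^sup>2 + 1) * cmod (q y)" for y
            using u by (intro Gq order_trans[OF norm_bounded]) auto
        qed auto
        also have "\<dots> \<le> 2 * c"
        proof -
          have "(2 * c)\<^sup>2 \<le> 1\<^sup>2" using c0 c(2) by (intro power_mono) auto
          then have "((2 * c)\<^sup>2 + 1) * c \<le> 2 * c" using c0 by (intro mult_right_mono) auto
          then show ?thesis by (simp add: c)
        qed
        finally show ?thesis by (simp add: \<Phi>)
      qed
      then show "\<Phi> u \<in> cball 0 (2 * c)" by (simp add: norm_bound)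
    qed
    show "dist (\<Phi> u) (\<Phi> v) \<le> 1 / 4 * dist u v" if "u \<in> cball 0 (2 * c)" "v \<in> cball 0 (2 * c)" for u v
    proof (rule dist_bound)
      fix x
      have "dist (\<Phi> u x) (\<Phi> v x) = cmod (resolvent m (\<lambda>y. G u y - G v y) x)"
        unfolding dist_norm \<Phi> resolvent_diff[OF assms(1) Gc Gb Gc Gb] ..
      also have "\<dots> \<le> (4 * c * dist u v) * (L2norm q / sqrt (2 * m))"
      proof (rule resolvent_bound_L2[OF assms(1,2)])
        show "continuous_on UNIV (\<lambda>y. G u y - G v y)" by (intro continuous_intros Gc)
        fix y
        have b: "cmod (u y) \<le> 2 * c" "cmod (v y) \<le> 2 * c"
          using that by (auto intro: order_trans[OF norm_bounded])
        have "cmod (G u y - G v y) = cmod (q y) * (cmod (u y + v y) * cmod (u y - v y))"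
          by (simp add: G_def power2_eq_square algebra_simps flip: norm_mult)
        also have "\<dots> \<le> cmod (q y) * ((4 * c) * dist u v)"
          using norm_triangle_mono[OF b] dist_bounded[of u y v]
          by (intro mult_left_mono mult_mono) (use c0 in \<open>auto simp: dist_norm\<close>)
        finally show "cmod (G u y - G v y) \<le> (4 * c * dist u v) * cmod (q y)" by (simp add: mult_ac)
      qed (use c0 in auto)
      also have "\<dots> = dist u v * (2 * c)\<^sup>2" by (simp add: c power2_eq_square)
      also have "\<dots> \<le> dist u v * (1 / 2)\<^sup>2"
        using c0 c(2) by (intro mult_left_mono power_mono) auto
      finally show "dist (\<Phi> u x) (\<Phi> v x) \<le> 1 / 4 * dist u v" by (simp add: power2_eq_square)
    qed
  qed (use c0 in \<open>auto simp: complete_eq_closed\<close>)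
  then obtain u where u: "u \<in> cball 0 (2 * c)" "\<Phi> u = u" by blast
  have Gb': "cmod (G u y) \<le> ((norm u)\<^sup>2 + 1) * K" for y
    using order_trans[OF Gq[OF norm_bounded] mult_left_mono[OF K]] by simp
  have "(apply_bcontfun u has_vector_derivative (m *\<^sub>R u x - G u x)) (at x)" for x
    using resolvent_has_derivative[OF assms(1) Gc Gb'] \<Phi>[of u] u(2) by simp
  moreover have "cmod (u x) \<le> 2 * c" for x
    using u(1) by (auto intro: order_trans[OF norm_bounded])
  ultimately show ?thesis using that unfolding G_def by blast
qed

section \<open>The linearised Riccati equation and dependence on a parameter\<close>

text \<open>The smallness of \<open>c\<close> lets the term \<open>b * f\<close> be absorbed into the left-hand side.\<close>

lemma linearised_riccati_bound:
  fixes q :: "real \<Rightarrow> complex"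
  assumes "m > 0" "quad_decay q" and c: "c = L2norm q / sqrt (2 * m)" "c \<le> 1 / 4"
    and f: "\<And>x. (f has_vector_derivative (m *\<^sub>R f x - (a x + b x * f x))) (at x)" "bounded (range f)"
    and "continuous_on UNIV a" "continuous_on UNIV b"
    and "\<And>y. cmod (a y) \<le> K" "\<And>y. cmod (b y) \<le> 4 * c * cmod (q y)"
  shows "cmod (f x) \<le> 2 * K / m"
proof -
  have c0: "c \<ge> 0" unfolding c L2norm_def using assms(1) by (simp add: integral_nonneg_AE)
  have K0: "K \<ge> 0" using assms(9) norm_ge_zero order_trans by blast
  obtain Q where Q: "Q \<ge> 0" "\<And>x. cmod (q x) \<le> Q" using quad_decayE[OF assms(2)] by metis
  have fc: "continuous_on UNIV f"
    using f(1) by (meson continuous_at_imp_continuous_on has_vector_derivative_continuous)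
  \<comment> \<open>The estimate of \<open>f\<close> through the resolvent will give
    \<open>M \<le> K / m + M / 4\<close>. Absorbing the last term requires \<open>M\<close> to be
    finite, which is where boundedness of \<open>f\<close> enters.\<close>
  define M where "M = (SUP x. cmod (f x))"
  have bdd: "bdd_above (range (\<lambda>x. cmod (f x)))"
    using f(2) by (auto simp: bounded_iff bdd_above_def)
  have fM: "cmod (f x) \<le> M" for x
    unfolding M_def by (rule cSUP_upper[OF _ bdd]) simp
  have M0: "M \<ge> 0" using fM norm_ge_zero order_trans by blast
  have bf: "cmod (b y * f y) \<le> (4 * c * M) * cmod (q y)" for y
    using mult_mono[OF assms(10)[of y] fM[of y]] c0 by (simp add: norm_mult mult_ac)
  have bf': "cmod (b y * f y) \<le> (4 * c * M) * Q" for y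
    using order_trans[OF bf mult_left_mono[OF Q(2)]] c0 M0 by simp
  have cont: "continuous_on UNIV (\<lambda>y. b y * f y)" by (intro continuous_intros assms fc)
  have "cmod (f x) \<le> K / m + M / 4" for x
  proof -
    have "f x = resolvent m (\<lambda>y. a y + b y * f y) x"
    proof (rule eq_resolvent[OF assms(1) f(1) _ _ fM])
      show "cmod (a y + b y * f y) \<le> K + (4 * c * M) * Q" for y
        using norm_triangle_mono[OF assms(9) bf'] .
    qed (intro continuous_intros assms fc)
    also have "\<dots> = resolvent m a x + resolvent m (\<lambda>y. b y * f y) x"
      using assms(9) bf' by (intro resolvent_add[symmetric] assms(1,7) cont) (auto simp: bounded_iff)
    also have "cmod \<dots> \<le> K / m + (4 * c * M) * (L2norm q / sqrt (2 * m))"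
      using c0 M0 by (intro norm_triangle_mono resolvent_bound_sup resolvent_bound_L2 assms cont bf) auto
    also have "(4 * c * M) * (L2norm q / sqrt (2 * m)) = M * (2 * c)\<^sup>2"
      by (simp add: c power2_eq_square)
    also have "\<dots> \<le> M * (1 / 2)\<^sup>2"
      using c0 c(2) M0 by (intro mult_left_mono power_mono) auto
    finally show ?thesis by (simp add: power2_eq_square)
  qed
  then have "M \<le> K / m + M / 4" unfolding M_def by (intro cSUP_least) auto
  then have "M \<le> 2 * (K / m)" using K0 M0 assms(1) by simp
  then show ?thesis using fM[of x] by simp
qed

text \<open>Stability of the linearised equation: the bound is uniform in the coefficient
  \<open>b h\<close>, so only the source \<open>a h\<close> has to become small. It is applied twice
  below, to differences of Riccati solutions and then to their difference quotients minus the
  expected derivative.\<close>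

lemma linearised_riccati_limit:
  fixes q :: "real \<Rightarrow> complex" and f :: "real \<Rightarrow> real \<Rightarrow> complex"
  assumes "m > 0" "quad_decay q" "c = L2norm q / sqrt (2 * m)" "c \<le> 1 / 4"
    and "\<And>h x. (f h has_vector_derivative (m *\<^sub>R f h x - (a h x + b h x * f h x))) (at x)"
    and "\<And>h. bounded (range (f h))" "\<And>h. continuous_on UNIV (a h)" "\<And>h. continuous_on UNIV (b h)"
    and "\<And>h y. cmod (b h y) \<le> 4 * c * cmod (q y)"
    and "uniform_limit UNIV a (\<lambda>_. 0) (at 0)"
  shows "uniform_limit UNIV f (\<lambda>_. 0) (at 0)"
proof (rule uniform_limitI)
  fix e :: real assume "e > 0"
  then have "e * m / 4 > 0" using assms(1) by simp
  from uniform_limitD[OF assms(10) this]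
  show "\<forall>\<^sub>F h in at 0. \<forall>x\<in>UNIV. dist (f h x) 0 < e"
  proof eventually_elim
    case (elim h)
    have b: "cmod (f h x) \<le> 2 * (e * m / 4) / m" for x
      by (rule linearised_riccati_bound[OF assms(1-8)])
         (use elim assms(9) in \<open>auto simp: less_imp_le\<close>)
    have "cmod (f h x) < e" for x
      using b[of x] \<open>e > 0\<close> assms(1) by simp
    then show ?case by simp
  qed
qed

lemma uniform_limit_of_quotient:
  fixes Q :: "real \<Rightarrow> real \<Rightarrow> complex"
  assumes "uniform_limit UNIV (\<lambda>h x. (Q h x - Q 0 x) /\<^sub>R h) p (at 0)" "bounded (range p)"
  shows "uniform_limit UNIV Q (Q 0) (at 0)"
proof -
  have "uniform_limit UNIV (\<lambda>h (x::real). complex_of_real h) (\<lambda>x. complex_of_real 0) (at 0)"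
    by (auto intro!: uniform_limitI simp: dist_norm eventually_at)
  from uniform_lim_mult[OF this assms(1)] assms(2)
  have "uniform_limit UNIV (\<lambda>h x. h * ((Q h x - Q 0 x) /\<^sub>R h)) (\<lambda>x. 0 * p x) (at 0)" by simp
  from uniform_limit_add[OF this uniform_limit_const[where c = "Q 0"]]
  moreover have "complex_of_real h * ((Q h x - Q 0 x) /\<^sub>R h) + Q 0 x = Q h x" for h x
    by (cases "h = 0") (simp_all add: scaleR_conv_of_real field_simps)
  ultimately show ?thesis by simp
qed

text \<open>The candidate derivative \<open>w\<close> is given as a bounded solution of the formally
  differentiated Riccati equation. Differences of Riccati solutions solve linear equations whose
  coefficient \<open>Q 0 * (U h + U 0)\<close> is at most 4 c |Q 0|, so the stability lemma gives
  first continuity of \<open>U\<close> in \<open>h\<close> and then, with this known, convergence of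
  the difference quotients to \<open>w\<close>.\<close>

lemma riccati_parameter_derivative:
  fixes Q U :: "real \<Rightarrow> real \<Rightarrow> complex" and s :: real
  assumes "m > 0" "\<And>h. quad_decay (Q h)" "\<bar>s\<bar> = 1" "c \<le> 1 / 4" "c = L2norm (Q 0) / sqrt (2 * m)"
    and U: "\<And>h x. (U h has_vector_derivative
                 (m *\<^sub>R U h x - (Q h x * (U h x)\<^sup>2 - s * cnj (Q h x)))) (at x)"
      "\<And>h x. cmod (U h x) \<le> 2 * c"
    and Qp: "uniform_limit UNIV (\<lambda>h x. (Q h x - Q 0 x) /\<^sub>R h) p (at 0)" "quad_decay p"
    and w: "\<And>x. (w has_vector_derivative
        (m *\<^sub>R w x - (p x * (U 0 x)\<^sup>2 - s * cnj (p x) + 2 * Q 0 x * U 0 x * w x))) (at x)" "bounded (range w)"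
  shows "uniform_limit UNIV (\<lambda>h x. (U h x - U 0 x) /\<^sub>R h) w (at 0)"
proof -
  have Uc: "continuous_on UNIV (U h)" for h
    using U(1) by (meson continuous_at_imp_continuous_on has_vector_derivative_continuous)
  have wc: "continuous_on UNIV w"
    using w(1) by (meson continuous_at_imp_continuous_on has_vector_derivative_continuous)
  have Qc: "continuous_on UNIV (Q h)" for h by (simp add: assms quad_decay_continuous)
  have pc: "continuous_on UNIV p" by (simp add: assms quad_decay_continuous)
  have bd: "bounded (range f)" if "quad_decay f" for f
    using quad_decayE[OF that] by (metis bounded_iff rangeE)
  have Ub: "bounded (range (U h))" for h using U(2) by (auto simp: bounded_iff)
  have Q0: "uniform_limit UNIV Q (Q 0) (at 0)"
    by (rule uniform_limit_of_quotient[OF Qp(1) bd[OF Qp(2)]])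
  have "uniform_limit UNIV (\<lambda>h x. U h x - U 0 x) (\<lambda>_. 0) (at 0)"
  proof (rule linearised_riccati_limit[OF assms(1) assms(2)[of 0] assms(5,4)])
    \<comment> \<open>Subtracting the equations for \<open>U h\<close> and \<open>U 0\<close> and
      factoring the difference of squares leaves a source proportional to the change of
      \<open>Q\<close> and its conjugate.\<close>
    let ?a = "\<lambda>h x. (Q h x - Q 0 x) * (U h x)\<^sup>2 - s * cnj (Q h x - Q 0 x)"
    let ?b = "\<lambda>h x. Q 0 x * (U h x + U 0 x)"
    show "((\<lambda>x. U h x - U 0 x) has_vector_derivative
       (m *\<^sub>R (U h x - U 0 x) - (?a h x + ?b h x * (U h x - U 0 x)))) (at x)" for h x
      by (rule derivative_eq_intros U refl)+ (simp add: algebra_simps power2_eq_square scaleR_conv_of_real)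
    show "bounded (range (\<lambda>x. U h x - U 0 x))" for h
      by (intro bounded_minus_comp Ub)
    show "continuous_on UNIV (?a h)" "continuous_on UNIV (?b h)" for h
      by (intro continuous_intros Qc Uc)+
    show "cmod (?b h y) \<le> 4 * c * cmod (Q 0 y)" for h y
      using mult_right_mono[OF norm_triangle_mono[OF U(2)[of h y] U(2)[of 0 y]], of "cmod (Q 0 y)"] by (simp add: norm_mult mult_ac)
    show "uniform_limit UNIV ?a (\<lambda>_. 0) (at 0)"
    proof (rule uniform_limitI)
      fix e :: real assume "e > 0"
      then have "e / 2 > 0" by simp
      from uniform_limitD[OF Q0 this]
      show "\<forall>\<^sub>F h in at 0. \<forall>x\<in>UNIV. dist (?a h x) 0 < e"
      proof eventually_elim
        case (elim h)
        have "cmod (?a h x) < e" for x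
        proof -
          have "cmod (U h x) \<le> 1" using U(2)[of h x] assms(4) by simp
          then have "(cmod (U h x))\<^sup>2 \<le> 1" by (simp add: power_le_one)
          then have "cmod (Q h x - Q 0 x) * (cmod (U h x))\<^sup>2 \<le> cmod (Q h x - Q 0 x) * 1"
            by (intro mult_left_mono) auto
          moreover have "cmod (?a h x) \<le> cmod (Q h x - Q 0 x) * (cmod (U h x))\<^sup>2 + cmod (Q h x - Q 0 x)"
            by (rule order_trans[OF norm_triangle_ineq4])
               (simp add: norm_mult norm_power assms(3) flip: complex_cnj_diff)
          moreover have "cmod (Q h x - Q 0 x) < e / 2" using elim by (simp add: dist_norm)
          ultimately show ?thesis by linarith
        qed
        then show ?case by simp
      qed
    qed
  qed
  from uniform_limit_add[OF this uniform_limit_const[where c = "U 0"]]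
  have U0: "uniform_limit UNIV U (U 0) (at 0)" by simp
  let ?P = "\<lambda>h x. (Q h x - Q 0 x) /\<^sub>R h"
  let ?D = "\<lambda>h x. (U h x - U 0 x) /\<^sub>R h - w x"
  have "uniform_limit UNIV ?D (\<lambda>_. 0) (at 0)"
  proof (rule linearised_riccati_limit[OF assms(1) assms(2)[of 0] assms(5,4)])
    \<comment> \<open>What is left after moving all multiples of \<open>?D h\<close> into
      \<open>?b h\<close>. Each summand contains a factor tending to 0: the error of the quotient of
      \<open>Q\<close>, or the increment of \<open>U\<close> or of its square.\<close>
    let ?a = "\<lambda>h x. (?P h x - p x) * (U h x * U h x) - s * cnj (?P h x - p x)
                + p x * (U h x * U h x - U 0 x * U 0 x) + Q 0 x * (U h x - U 0 x) * w x"
    let ?b = "\<lambda>h x. Q 0 x * (U h x + U 0 x)"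
    show "(?D h has_vector_derivative (m *\<^sub>R ?D h x - (?a h x + ?b h x * ?D h x))) (at x)" for h x
      by (rule derivative_eq_intros U w refl)+ (simp add: algebra_simps power2_eq_square scaleR_conv_of_real)
    show "bounded (range (?D h))" for h
    proof -
      have "bounded (range (\<lambda>x. inverse h *\<^sub>R (U h x - U 0 x)))"
        by (intro bounded_scaleR_comp bounded_minus_comp Ub)
      then show ?thesis by (intro bounded_minus_comp w(2))
    qed
    show "continuous_on UNIV (?a h)" "continuous_on UNIV (?b h)" for h
      by (intro continuous_intros Qc Uc pc wc)+
    show "cmod (?b h y) \<le> 4 * c * cmod (Q 0 y)" for h y
      using mult_right_mono[OF norm_triangle_mono[OF U(2)[of h y] U(2)[of 0 y]], of "cmod (Q 0 y)"] by (simp add: norm_mult mult_ac)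
    have bU2: "bounded (range (\<lambda>x. U 0 x * U 0 x))"
    proof -
      have "cmod (U 0 x * U 0 x) \<le> (2 * c) * (2 * c)" for x
        unfolding norm_mult using U(2)[of 0 x] order_trans[OF norm_ge_zero U(2)[of 0 x]] by (intro mult_mono) auto
      then show ?thesis by (auto simp: bounded_iff)
    qed
    have UU: "uniform_limit UNIV (\<lambda>h x. U h x * U h x) (\<lambda>x. U 0 x * U 0 x) (at 0)"
      by (intro uniform_lim_mult U0 Ub)
    have PP: "uniform_limit UNIV (\<lambda>h x. ?P h x - p x) (\<lambda>x. p x - p x) (at 0)"
      by (intro uniform_limit_minus Qp uniform_limit_const)
    have "uniform_limit UNIV ?a (\<lambda>x. (p x - p x) * (U 0 x * U 0 x) - s * cnj (p x - p x)
                + p x * (U 0 x * U 0 x - U 0 x * U 0 x) + Q 0 x * (U 0 x - U 0 x) * w x) (at 0)"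
      using bd[OF Qp(2)] bd[OF assms(2)[of 0]] w(2) bU2
      by (intro uniform_limit_add uniform_limit_minus uniform_lim_mult UU PP U0 uniform_limit_const
           bounded_linear.uniform_limit[OF bounded_linear_cnj]) auto
    then show "uniform_limit UNIV ?a (\<lambda>_. 0) (at 0)" by simp
  qed
  from uniform_limit_add[OF this uniform_limit_const[where c = w]]
  show ?thesis by simp
qed

section \<open>Conservation laws\<close>

lemma quad_decay_bounded: "quad_decay f \<Longrightarrow> bounded (range f)"
  using quad_decayE[of f] by (metis bounded_iff rangeE)

lemma quad_decay_bounded_weighted:
  assumes "quad_decay f"
  shows "bounded (range (\<lambda>x. (1 + x\<^sup>2) *\<^sub>R f x))"
proof -
  obtain K where K: "\<And>x. cmod (f x) \<le> K / (1 + x\<^sup>2)"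
    using quad_decayE[OF assms] by metis
  have "cmod ((1 + x\<^sup>2) *\<^sub>R f x) \<le> K" for x
  proof -
    have "0 < 1 + x\<^sup>2" by (simp add: add_pos_nonneg)
    then show ?thesis using K[of x] by (simp add: pos_le_divide_eq mult.commute)
  qed
  then show ?thesis by (auto simp: bounded_iff)
qed

text \<open>Uniform convergence alone does not pass to integrals over the whole line; with the
  weight \<open>1 + x\<^sup>2\<close> the error has the integrable majorant const / (1 +
  x^2).\<close>

lemma tendsto_integral_weighted:
  fixes F :: "real \<Rightarrow> real \<Rightarrow> complex"
  assumes "uniform_limit UNIV (\<lambda>h x. (1 + x\<^sup>2) *\<^sub>R F h x) (\<lambda>x. (1 + x\<^sup>2) *\<^sub>R G x) (at 0)"
    and F: "\<And>h. integrable lborel (F h)" and G: "integrable lborel G"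
  shows "((\<lambda>h. LINT x|lborel. F h x) \<longlongrightarrow> (LINT x|lborel. G x)) (at 0)"
proof (rule tendstoI)
  fix e :: real assume e: "e > 0"
  define I where "I = (LINT x::real|lborel. 1 / (1 + x\<^sup>2))"
  have I0: "I \<ge> 0" unfolding I_def by (intro integral_nonneg_AE) (auto intro!: AE_I2)
  \<comment> \<open>\<open>I + 1\<close> rather than \<open>I\<close> keeps the denominator positive
    using only \<open>I \<ge> 0\<close>, and makes the final inequality strict.\<close>
  then have "e / (I + 1) > 0" using e by simp
  from uniform_limitD[OF assms(1) this]
  show "\<forall>\<^sub>F h in at 0. dist (LINT x|lborel. F h x) (LINT x|lborel. G x) < e"
  proof eventually_elim
    case (elim h)
    have *: "cmod (F h x - G x) \<le> e / (I + 1) * (1 / (1 + x\<^sup>2))" for x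
    proof -
      have p: "0 < 1 + x\<^sup>2" by (simp add: add_pos_nonneg)
      have "cmod ((1 + x\<^sup>2) *\<^sub>R (F h x - G x)) < e / (I + 1)"
        using elim by (simp add: dist_norm scaleR_diff_right)
      then have "(1 + x\<^sup>2) * cmod (F h x - G x) < e / (I + 1)"
        using p by (simp only: norm_scaleR abs_of_pos)
      then have "cmod (F h x - G x) \<le> e / (I + 1) / (1 + x\<^sup>2)"
        using p by (subst pos_le_divide_eq) (auto simp: mult.commute less_imp_le)
      then show ?thesis by simp
    qed
    have "dist (LINT x|lborel. F h x) (LINT x|lborel. G x) = cmod (LINT x|lborel. F h x - G x)"
      by (simp add: dist_norm F G)
    also have "\<dots> \<le> (LINT x|lborel. cmod (F h x - G x))" by (rule integral_norm_bound)
    also have "\<dots> \<le> (LINT x|lborel. e / (I + 1) * (1 / (1 + x\<^sup>2)))"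
      by (intro integral_mono * integrable_norm Bochner_Integration.integrable_diff F G
            integrable_mult_right integrable_inverse_1_plus_sq)
    also have "\<dots> = e * (I / (I + 1))"
    proof -
      have "(LINT x::real|lborel. e / (I + 1) * (1 / (1 + x\<^sup>2))) = e / (I + 1) * I"
        unfolding I_def by (rule integral_mult_right_zero)
      then show ?thesis by simp
    qed
    also have "\<dots> < e * 1" using I0 e by (intro mult_strict_left_mono) auto
    finally show ?case by simp
  qed
qed

lemma has_vector_derivativeI_quotient:
  fixes f :: "real \<Rightarrow> complex"
  assumes "((\<lambda>h. (f (t + h) - f t) /\<^sub>R h) \<longlongrightarrow> D) (at 0)"
  shows "(f has_vector_derivative D) (at t)"
proof -
  have "((\<lambda>h. cmod ((f (t + h) - f t) /\<^sub>R h - D)) \<longlongrightarrow> 0) (at 0)"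
    using assms by (simp add: LIM_zero tendsto_norm_zero)
  then have "((\<lambda>h. cmod (f (t + h) - f t - h *\<^sub>R D) / norm h) \<longlongrightarrow> 0) (at 0)"
  proof (rule Lim_transform_eventually)
    have "cmod ((f (t + h) - f t) /\<^sub>R h - D) = cmod (f (t + h) - f t - h *\<^sub>R D) / norm h" if "h \<noteq> 0" for h
    proof -
      have "(f (t + h) - f t) /\<^sub>R h - D = (f (t + h) - f t - h *\<^sub>R D) /\<^sub>R h"
        using that by (simp add: scaleR_diff_right)
      then show ?thesis by (simp add: divide_inverse mult.commute)
    qed
    then show "\<forall>\<^sub>F h in at 0. cmod ((f (t + h) - f t) /\<^sub>R h - D) = cmod (f (t + h) - f t - h *\<^sub>R D) / norm h"
      by (simp add: eventually_at_filter)
  qed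
  then show ?thesis
    unfolding has_vector_derivative_def has_derivative_at by (simp add: bounded_linear_scaleR_left)
qed

text \<open>Differentiation under the integral sign. The weight of the preceding limit lemma is
  carried entirely by \<open>q\<close> and its difference quotient, so for \<open>u\<close>
  unweighted uniform convergence suffices.\<close>

lemma integral_product_has_derivative:
  fixes q u :: "real \<Rightarrow> real \<Rightarrow> complex"
  assumes q: "\<And>t. quad_decay (q t)" and u: "\<And>t. continuous_on UNIV (u t)" "\<And>t. bounded (range (u t))"
    and W: "uniform_limit UNIV (\<lambda>h x. (1 + x\<^sup>2) *\<^sub>R ((q (t + h) x - q t x) /\<^sub>R h)) (\<lambda>x. (1 + x\<^sup>2) *\<^sub>R p x) (at 0)"
    and p: "quad_decay p"
    and U: "uniform_limit UNIV (\<lambda>h x. (u (t + h) x - u t x) /\<^sub>R h) w (at 0)"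
    and w: "continuous_on UNIV w" "bounded (range w)"
  shows "((\<lambda>t. LINT x|lborel. q t x * u t x) has_vector_derivative
          (LINT x|lborel. p x * u t x + q t x * w x)) (at t)"
proof (rule has_vector_derivativeI_quotient)
  have qb: "quad_decay (\<lambda>x. f x * g x)" if "quad_decay f" "continuous_on UNIV g" "bounded (range g)" for f g
    using that by (auto simp: bounded_iff intro: quad_decay_mult_bounded)
  have qu: "quad_decay (\<lambda>x. q t' x * u t x)" for t t' by (intro qb q u)
  have U0: "uniform_limit UNIV (\<lambda>h. u (t + h)) (u t) (at 0)"
    using uniform_limit_of_quotient[of "\<lambda>h. u (t + h)" w] U w by simp
  \<comment> \<open>The discrete product rule for the difference quotient of
    \<open>q * u\<close>.\<close>
  let ?F = "\<lambda>h x. ((q (t + h) x - q t x) /\<^sub>R h) * u (t + h) x + q t x * ((u (t + h) x - u t x) /\<^sub>R h)"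
  have Fi: "?F h = (\<lambda>x. (q (t + h) x * u (t + h) x - q t x * u t x) /\<^sub>R h)" for h
    by (simp add: fun_eq_iff scaleR_conv_of_real algebra_simps)
  have "((\<lambda>h. LINT x|lborel. ?F h x) \<longlongrightarrow> (LINT x|lborel. p x * u t x + q t x * w x)) (at 0)"
  proof (rule tendsto_integral_weighted)
    have "uniform_limit UNIV (\<lambda>h x. (1 + x\<^sup>2) *\<^sub>R ((q (t + h) x - q t x) /\<^sub>R h) * u (t + h) x
          + (1 + x\<^sup>2) *\<^sub>R q t x * ((u (t + h) x - u t x) /\<^sub>R h))
        (\<lambda>x. (1 + x\<^sup>2) *\<^sub>R p x * u t x + (1 + x\<^sup>2) *\<^sub>R q t x * w x) (at 0)"
      by (intro uniform_limit_add uniform_lim_mult W U0 U uniform_limit_const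
            quad_decay_bounded_weighted p q u w)
    then show "uniform_limit UNIV (\<lambda>h x. (1 + x\<^sup>2) *\<^sub>R ?F h x)
        (\<lambda>x. (1 + x\<^sup>2) *\<^sub>R (p x * u t x + q t x * w x)) (at 0)"
      by (simp add: scaleR_add_right mult_ac)
    show "integrable lborel (?F h)" for h
      unfolding Fi by (intro integrable_scaleR_right Bochner_Integration.integrable_diff
          quad_decay_integrable qu)
    show "integrable lborel (\<lambda>x. p x * u t x + q t x * w x)"
      by (intro quad_decay_integrable quad_decay_add qb p q u w)
  qed
  then show "((\<lambda>h. ((LINT x|lborel. q (t + h) x * u (t + h) x) - (LINT x|lborel. q t x * u t x)) /\<^sub>R h)
      \<longlongrightarrow> (LINT x|lborel. p x * u t x + q t x * w x)) (at 0)"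
    unfolding Fi by (simp add: quad_decay_integrable[OF qu])
qed

lemma constant_of_derivative_zero:
  fixes f :: "real \<Rightarrow> complex"
  assumes "\<And>t. (f has_vector_derivative 0) (at t)"
  shows "f t = f 0"
  using has_vector_derivative_zero_constant[of UNIV f] assms by (metis UNIV_I convex_UNIV)

lemma schwartz_curve_quad_decay:
  assumes "schwartz_curve q p"
  shows "quad_decay (q t)" "quad_decay (p t)"
  using assms schwartz_quad_decay[of _ 0] by (auto simp: schwartz_curve_def)

lemma schwartz_curve_quotient:
  assumes "schwartz_curve q p"
  shows "uniform_limit UNIV (\<lambda>h x. (q (t + h) x - q t x) /\<^sub>R h) (p t) (at 0)"
    and "uniform_limit UNIV (\<lambda>h x. (1 + x\<^sup>2) *\<^sub>R ((q (t + h) x - q t x) /\<^sub>R h)) (\<lambda>x. (1 + x\<^sup>2) *\<^sub>R p t x) (at 0)"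
proof -
  have *: "uniform_limit UNIV (\<lambda>h x. x ^ k *\<^sub>R ((q (t + h) x - q t x) /\<^sub>R h - p t x)) (\<lambda>x. 0) (at 0)" for k
  proof -
    have "uniform_limit UNIV
        (\<lambda>h x. x ^ k *\<^sub>R (xderiv ^^ 0) (\<lambda>y. (q (t + h) y - q t y) /\<^sub>R h - p t y) x) (\<lambda>x. 0) (at 0)"
      using assms unfolding schwartz_curve_def has_schwartz_derivative_def by blast
    then show ?thesis by simp
  qed
  from uniform_limit_add[OF *[of 0] uniform_limit_const[where c = "p t"]]
  show "uniform_limit UNIV (\<lambda>h x. (q (t + h) x - q t x) /\<^sub>R h) (p t) (at 0)" by simp
  \<comment> \<open>The seminorms with exponents 0 and 2 together produce the weight
    \<open>1 + x\<^sup>2\<close>.\<close>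
  from uniform_limit_add[OF uniform_limit_add[OF *[of 0] *[of 2]] uniform_limit_const[where c = "\<lambda>x. (1 + x\<^sup>2) *\<^sub>R p t x"]]
  show "uniform_limit UNIV (\<lambda>h x. (1 + x\<^sup>2) *\<^sub>R ((q (t + h) x - q t x) /\<^sub>R h)) (\<lambda>x. (1 + x\<^sup>2) *\<^sub>R p t x) (at 0)"
    by (simp add: algebra_simps)
qed

text \<open>\<open>F\<close> is the flux of the mass density: its x-derivative is the formal time
  derivative of q * cnj q, so the time derivative of the mass integrates to 0.\<close>

lemma L2norm_conserved:
  assumes "schwartz_curve q p"
    and F: "\<And>t x. (F t has_vector_derivative (p t x * cnj (q t x) + q t x * cnj (p t x))) (at x)"
      "\<And>t. quad_decay (F t)"
  shows "L2norm (q t) = L2norm (q 0)"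
proof -
  note [simp] = schwartz_curve_quad_decay[OF assms(1)]
  have "((\<lambda>t. LINT x|lborel. q t x * cnj (q t x)) has_vector_derivative 0) (at t)" for t
  proof -
    have "uniform_limit UNIV (\<lambda>h x. cnj ((q (t + h) x - q t x) /\<^sub>R h)) (\<lambda>x. cnj (p t x)) (at 0)"
      by (intro bounded_linear.uniform_limit[OF bounded_linear_cnj] schwartz_curve_quotient[OF assms(1)])
    then have U: "uniform_limit UNIV (\<lambda>h x. (cnj (q (t + h) x) - cnj (q t x)) /\<^sub>R h) (\<lambda>x. cnj (p t x)) (at 0)"
      by simp
    have "((\<lambda>t. LINT x|lborel. q t x * cnj (q t x)) has_vector_derivative
          (LINT x|lborel. p t x * cnj (q t x) + q t x * cnj (p t x))) (at t)"
      by (intro integral_product_has_derivative[OF _ _ _ schwartz_curve_quotient(2)[OF assms(1)] _ U])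
         (auto simp: quad_decay_continuous quad_decay_bounded quad_decay_cnj)
    moreover have "(LINT x|lborel. p t x * cnj (q t x) + q t x * cnj (p t x)) = 0"
      by (rule integral_of_derivative_eq_0[OF F(1)])
         (auto simp: quad_decay_tendsto F intro!: quad_decay_add quad_decay_mult quad_decay_cnj)
    ultimately show ?thesis by simp
  qed
  from constant_of_derivative_zero[of "\<lambda>t. LINT x|lborel. q t x * cnj (q t x)", OF this]
  have "(LINT x|lborel. q t x * cnj (q t x)) = (LINT x|lborel. q 0 x * cnj (q 0 x))" .
  moreover have "(LINT x|lborel. q t x * cnj (q t x)) = complex_of_real (LINT x|lborel. (cmod (q t x))\<^sup>2)" for t
    by (simp only: complex_norm_square flip: integral_complex_of_real)
  ultimately show ?thesis by (simp add: L2norm_def)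
qed

text \<open>With \<open>p\<close> and \<open>rt\<close> for the time derivatives of \<open>q\<close>
  and \<open>r\<close>, the left side is the x-derivative of C - 2 A u - B u^2 computed from the
  zero curvature and Riccati equations. The identity says that this expression solves the Riccati
  equation differentiated in time.\<close>

lemma riccati_evolution_algebra: fixes A B C u q p r rt m :: complex
  shows "(rt + m * C + 2 * r * A) - 2 * (A * (m * u - (q * u\<^sup>2 - r)) + (q * C - r * B) * u)
    - (B * (u * (m * u - (q * u\<^sup>2 - r)) + (m * u - (q * u\<^sup>2 - r)) * u) + (p - m * B - 2 * q * A) * (u * u))
   = m * (C - 2 * (A * u) - B * (u * u)) - (p * u\<^sup>2 - rt + 2 * q * u * (C - 2 * (A * u) - B * (u * u)))"
  by (simp add: power2_eq_square algebra_simps)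
text \<open>If \<psi> is a joint solution of the two linear systems, with \<open>u\<close> the ratio
  of its second to its first component, then q u - m/2 and A + B u are the x- and t-derivatives of
  the logarithm of the first component. The identity expresses equality of the mixed
  derivatives.\<close>

lemma riccati_flux_algebra: fixes A B C u q p r rt m :: complex
  shows "(q * C - r * B) + (B * (m * u - (q * u\<^sup>2 - r)) + (p - m * B - 2 * q * A) * u)
   = p * u + q * (C - 2 * A * u - B * u\<^sup>2)"
  by (simp add: power2_eq_square algebra_simps)

text \<open>
  The hypotheses on \<open>A\<close>, \<open>B\<close>, \<open>C\<close> say that \<open>[[- m/2, q], [r, m/2]]\<close> and \<open>[[A, B], [C, - A]]\<close>, where
  \<open>r = s * cnj q\<close>, form a zero curvature pair. The time derivative of \<open>u\<close> is then \<open>w\<close> below, and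
  \<open>A + B * u\<close> is the flux of \<open>q * u\<close>.
\<close>

lemma zero_curvature_conservation:
  fixes s m :: real and a :: complex and A B C :: "real \<Rightarrow> real \<Rightarrow> complex"
  assumes q: "schwartz_curve q p" and "\<bar>s\<bar> = 1" "m > 0"
    and c: "\<And>t. c = L2norm (q t) / sqrt (2 * m)" "c \<le> 1 / 4"
    and u: "\<And>t x. (u t has_vector_derivative
                 (m *\<^sub>R u t x - (q t x * (u t x)\<^sup>2 - s * cnj (q t x)))) (at x)"
      "\<And>t x. cmod (u t x) \<le> 2 * c"
    and A: "\<And>t x. (A t has_vector_derivative (q t x * C t x - s * cnj (q t x) * B t x)) (at x)"
      "\<And>t. quad_decay (\<lambda>x. A t x - a)"
    and B: "\<And>t x. (B t has_vector_derivative (p t x - m * B t x - 2 * q t x * A t x)) (at x)"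
      "\<And>t. quad_decay (B t)"
    and C: "\<And>t x. (C t has_vector_derivative (s * cnj (p t x) + m * C t x + 2 * (s * cnj (q t x)) * A t x)) (at x)"
      "\<And>t. quad_decay (C t)"
  shows "(LINT x|lborel. q t x * u t x) = (LINT x|lborel. q 0 x * u 0 x)"
proof -
  note qd[simp] = schwartz_curve_quad_decay[OF q] B(2) C(2)
  note [simp] = quad_decay_bounded quad_decay_continuous
  \<comment> \<open>The equation \<psi>_t = [[A, B], [C, - A]] \<psi> induces this quadratic vector
    field on the ratio of the components of \<psi>, just as the spatial system induces the Riccati
    equation.\<close>
  define w where "w = (\<lambda>t x. C t x - 2 * A t x * u t x - B t x * (u t x)\<^sup>2)"
  have uc: "continuous_on UNIV (u t)" for t
    using u(1) by (meson continuous_at_imp_continuous_on has_vector_derivative_continuous)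
  have Ac: "continuous_on UNIV (A t)" for t
    using A(1) by (meson continuous_at_imp_continuous_on has_vector_derivative_continuous)
  have wc: "continuous_on UNIV (w t)" for t
    unfolding w_def by (intro continuous_intros uc Ac) auto
  have ub: "bounded (range (u t))" for t using u(2) by (auto simp: bounded_iff)
  have mult: "bounded (range (\<lambda>x. f x * g x))" if fg: "bounded (range f)" "bounded (range g)" for f g :: "real \<Rightarrow> complex"
  proof -
    obtain K where K: "\<And>x. cmod (f x) \<le> K"
      using fg(1) by (auto simp: bounded_iff)
    obtain L where L: "\<And>x. cmod (g x) \<le> L"
      using fg(2) by (auto simp: bounded_iff)
    have "cmod (f x * g x) \<le> K * L" for x
      unfolding norm_mult using order_trans[OF norm_ge_zero K] by (intro mult_mono K L) auto
    then show ?thesis by (auto simp: bounded_iff)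
  qed
  have Ab: "bounded (range (A t))" for t
    using bounded_plus_comp[OF quad_decay_bounded[OF A(2)[of t]], of "\<lambda>_. a"] by simp
  have wb: "bounded (range (w t))" for t
    unfolding w_def power2_eq_square
    by (intro bounded_minus_comp mult ub Ab) auto
  have qb: "quad_decay (\<lambda>x. f x * g x)" if "quad_decay f" "continuous_on UNIV g" "bounded (range g)" for f g
    using that by (auto simp: bounded_iff intro: quad_decay_mult_bounded)
  have u': "(u t has_vector_derivative (m * u t x - (q t x * (u t x)\<^sup>2 - s * cnj (q t x)))) (at x)" for t x
    using u(1)[of t x] by (simp only: scaleR_conv_of_real)
  have w': "(w t has_vector_derivative
        (m *\<^sub>R w t x - (p t x * (u t x)\<^sup>2 - s * cnj (p t x) + 2 * q t x * u t x * w t x))) (at x)" for t x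
  proof -
    have "((\<lambda>x. C t x - 2 * (A t x * u t x) - B t x * (u t x * u t x)) has_vector_derivative
        (m * (C t x - 2 * (A t x * u t x) - B t x * (u t x * u t x)) - (p t x * (u t x)\<^sup>2 - s * cnj (p t x)
          + 2 * q t x * u t x * (C t x - 2 * (A t x * u t x) - B t x * (u t x * u t x))))) (at x)"
      by (rule has_vector_derivative_eq_rhs,
          (rule A(1) B(1) C(1) u' has_vector_derivative_diff has_vector_derivative_mult_right
            has_vector_derivative_mult)+,
          rule riccati_evolution_algebra)
    then show ?thesis
      by (simp only: w_def power2_eq_square mult.assoc scaleR_conv_of_real)
  qed
  have "((\<lambda>t. LINT x|lborel. q t x * u t x) has_vector_derivative 0) (at t)" for t
  proof -
    have U: "uniform_limit UNIV (\<lambda>h x. (u (t + h) x - u t x) /\<^sub>R h) (w t) (at 0)"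
      using riccati_parameter_derivative[of m "\<lambda>h. q (t + h)" s c "\<lambda>h. u (t + h)" "p t" "w t",
          OF assms(3) qd(1) assms(2) c(2) c(1) u(1) u(2)]
        schwartz_curve_quotient(1)[OF q, of t] w' wb by (simp only: add_0_right qd)
    have "((\<lambda>t. LINT x|lborel. q t x * u t x) has_vector_derivative
          (LINT x|lborel. p t x * u t x + q t x * w t x)) (at t)"
      by (intro integral_product_has_derivative[OF _ _ _ schwartz_curve_quotient(2)[OF q] _ U] uc ub wc wb qd)
    moreover have "(LINT x|lborel. p t x * u t x + q t x * w t x) = 0"
    proof (rule integral_of_derivative_eq_0)
      \<comment> \<open>Subtracting the constant \<open>a\<close>, the limit of \<open>A\<close> at
        both ends, leaves the derivative unchanged and makes the flux vanish at infinity.\<close>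
      show "((\<lambda>x. (A t x - a) + B t x * u t x) has_vector_derivative (p t x * u t x + q t x * w t x)) (at x)" for x
        by (rule has_vector_derivative_eq_rhs,
            (rule A(1) B(1) u' has_vector_derivative_add has_vector_derivative_diff_const[THEN iffD2]
              has_vector_derivative_mult)+,
            unfold w_def, rule riccati_flux_algebra)
      have "quad_decay (\<lambda>x. (A t x - a) + B t x * u t x)"
        by (intro quad_decay_add A qb uc ub) auto
      from quad_decay_tendsto[OF this]
      show "((\<lambda>x. (A t x - a) + B t x * u t x) \<longlongrightarrow> 0) at_top"
        "((\<lambda>x. (A t x - a) + B t x * u t x) \<longlongrightarrow> 0) at_bot" .
      show "quad_decay (\<lambda>x. p t x * u t x + q t x * w t x)"
        by (intro quad_decay_add qb uc ub wc wb) auto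
    qed
    ultimately show ?thesis by simp
  qed
  from constant_of_derivative_zero[of "\<lambda>t. LINT x|lborel. q t x * u t x", OF this]
  show ?thesis .
qed

section \<open>Zero curvature representations of NLS and mKdV\<close>

lemma schwartz_curve_derivs:
  assumes "schwartz_curve q p"
  shows "((xderiv ^^ n) (q t) has_vector_derivative (xderiv ^^ Suc n) (q t) x) (at x)"
    and "quad_decay ((xderiv ^^ n) (q t))"
  using assms by (simp_all add: schwartz_curve_def schwartz_has_derivative schwartz_quad_decay del: funpow.simps)

text \<open>The second flow of the AKNS hierarchy, with entries polynomial of degree at most 2 in
  \<open>m\<close>. The equation is solved for \<open>p\<close> first; the witnesses are then
  verified by expansion. In the mass flux \<open>F\<close> the cubic term leaves no trace, because s
  is real.\<close>

lemma nls_zero_curvature: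
  fixes m :: real
  assumes "nls_solution s q"
  obtains p F A B C :: "real \<Rightarrow> real \<Rightarrow> complex" and a :: complex where "schwartz_curve q p"
    "\<And>t x. (F t has_vector_derivative (p t x * cnj (q t x) + q t x * cnj (p t x))) (at x)"
    "\<And>t. quad_decay (F t)"
    "\<And>t x. (A t has_vector_derivative (q t x * C t x - s * cnj (q t x) * B t x)) (at x)"
    "\<And>t. quad_decay (\<lambda>x. A t x - a)"
    "\<And>t x. (B t has_vector_derivative (p t x - m * B t x - 2 * q t x * A t x)) (at x)"
    "\<And>t. quad_decay (B t)"
    "\<And>t x. (C t has_vector_derivative (s * cnj (p t x) + m * C t x + 2 * (s * cnj (q t x)) * A t x)) (at x)"
    "\<And>t. quad_decay (C t)"
proof -
  obtain p where q: "schwartz_curve q p"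
    and p0: "\<And>t x. \<i> * p t x = - (xderiv ^^ 2) (q t) x + complex_of_real (s * 2 * (cmod (q t x))\<^sup>2) * q t x"
    using assms unfolding nls_solution_def by blast
  define q1 where "q1 = (\<lambda>t. xderiv (q t))"
  define q2 where "q2 = (\<lambda>t. (xderiv ^^ 2) (q t))"
  have d: "(q t has_vector_derivative q1 t x) (at x)" "(q1 t has_vector_derivative q2 t x) (at x)" for t x
    using schwartz_curve_derivs(1)[OF q, of 0 t x] schwartz_curve_derivs(1)[OF q, of 1 t x]
    by (simp_all add: q1_def q2_def numeral_2_eq_2)
  have qd: "quad_decay (q t)" "quad_decay (q1 t)" "quad_decay (q2 t)" for t
    using schwartz_curve_derivs(2)[OF q, of 0 t] schwartz_curve_derivs(2)[OF q, of 1 t]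
      schwartz_curve_derivs(2)[OF q, of 2 t]
    by (simp_all add: q1_def q2_def)
  have p: "p t x = \<i> * q2 t x - 2 * \<i> * s * q t x * q t x * cnj (q t x)" for t x
  proof -
    have "p t x = - \<i> * (\<i> * p t x)" by simp
    also have "\<dots> = - \<i> * (- q2 t x + s * 2 * (q t x * cnj (q t x)) * q t x)"
      unfolding p0 q2_def by (simp add: complex_norm_square del: of_real_power)
    finally show ?thesis by (simp add: algebra_simps)
  qed
  note deriv = d has_vector_derivative_cnj has_vector_derivative_add has_vector_derivative_diff
    has_vector_derivative_minus has_vector_derivative_const has_vector_derivative_mult_right
    has_vector_derivative_mult
  note decay = qd quad_decay_add quad_decay_diff quad_decay_minus quad_decay_cnj quad_decay_scale quad_decay_mult
  let ?F = "\<lambda>t x. \<i> * (q1 t x * cnj (q t x) - q t x * cnj (q1 t x))"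
  let ?A = "\<lambda>t x. \<i> * m\<^sup>2 / 2 - (\<i> * s) * (q t x * cnj (q t x))"
  let ?B = "\<lambda>t x. \<i> * q1 t x - (\<i> * m) * q t x"
  let ?C = "\<lambda>t x. - (\<i> * s) * cnj (q1 t x) - (\<i> * m * s) * cnj (q t x)"
  show ?thesis
  proof (rule that[of p ?F ?A ?C ?B "\<i> * m\<^sup>2 / 2"])
    fix t x
    show "(?F t has_vector_derivative (p t x * cnj (q t x) + q t x * cnj (p t x))) (at x)"
      by (rule has_vector_derivative_eq_rhs, (rule deriv)+) (simp add: p algebra_simps)
    show "(?A t has_vector_derivative (q t x * ?C t x - s * cnj (q t x) * ?B t x)) (at x)"
      by (rule has_vector_derivative_eq_rhs, (rule deriv)+) (simp add: p algebra_simps)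
    show "(?B t has_vector_derivative (p t x - m * ?B t x - 2 * q t x * ?A t x)) (at x)"
      by (rule has_vector_derivative_eq_rhs, (rule deriv)+) (simp add: p algebra_simps power2_eq_square)
    show "(?C t has_vector_derivative (s * cnj (p t x) + m * ?C t x + 2 * (s * cnj (q t x)) * ?A t x)) (at x)"
      by (rule has_vector_derivative_eq_rhs, (rule deriv)+) (simp add: p algebra_simps power2_eq_square)
    have "quad_decay (\<lambda>x. - ((\<i> * s) * (q t x * cnj (q t x))))" by (intro decay)
    then show "quad_decay (\<lambda>x. ?A t x - \<i> * m\<^sup>2 / 2)" by simp
  qed (intro q decay)+
qed

text \<open>The third flow of the same hierarchy, with entries of degree at most 3 in
  \<open>m\<close>. Here the nonlinearity does contribute to the mass flux, through the term 3 s
  |q|^4.\<close>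

lemma mkdv_zero_curvature:
  fixes m :: real
  assumes "mkdv_solution s q"
  obtains p F A B C :: "real \<Rightarrow> real \<Rightarrow> complex" and a :: complex where "schwartz_curve q p"
    "\<And>t x. (F t has_vector_derivative (p t x * cnj (q t x) + q t x * cnj (p t x))) (at x)"
    "\<And>t. quad_decay (F t)"
    "\<And>t x. (A t has_vector_derivative (q t x * C t x - s * cnj (q t x) * B t x)) (at x)"
    "\<And>t. quad_decay (\<lambda>x. A t x - a)"
    "\<And>t x. (B t has_vector_derivative (p t x - m * B t x - 2 * q t x * A t x)) (at x)"
    "\<And>t. quad_decay (B t)"
    "\<And>t x. (C t has_vector_derivative (s * cnj (p t x) + m * C t x + 2 * (s * cnj (q t x)) * A t x)) (at x)"
    "\<And>t. quad_decay (C t)"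
proof -
  obtain p where q: "schwartz_curve q p"
    and p0: "\<And>t x. p t x = - (xderiv ^^ 3) (q t) x + complex_of_real (s * 6 * (cmod (q t x))\<^sup>2) * xderiv (q t) x"
    using assms unfolding mkdv_solution_def by blast
  define q1 where "q1 = (\<lambda>t. xderiv (q t))"
  define q2 where "q2 = (\<lambda>t. (xderiv ^^ 2) (q t))"
  define q3 where "q3 = (\<lambda>t. (xderiv ^^ 3) (q t))"
  have d: "(q t has_vector_derivative q1 t x) (at x)" "(q1 t has_vector_derivative q2 t x) (at x)"
    "(q2 t has_vector_derivative q3 t x) (at x)" for t x
    using schwartz_curve_derivs(1)[OF q, of 0 t x] schwartz_curve_derivs(1)[OF q, of 1 t x]
      schwartz_curve_derivs(1)[OF q, of 2 t x]
    by (simp_all add: q1_def q2_def q3_def numeral_2_eq_2 numeral_3_eq_3)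
  have qd: "quad_decay (q t)" "quad_decay (q1 t)" "quad_decay (q2 t)" "quad_decay (q3 t)" for t
    using schwartz_curve_derivs(2)[OF q, of 0 t] schwartz_curve_derivs(2)[OF q, of 1 t]
      schwartz_curve_derivs(2)[OF q, of 2 t] schwartz_curve_derivs(2)[OF q, of 3 t]
    by (simp_all add: q1_def q2_def q3_def)
  have p: "p t x = - q3 t x + 6 * s * q t x * cnj (q t x) * q1 t x" for t x
    unfolding p0 q3_def q1_def by (simp add: complex_norm_square del: of_real_power)
  note deriv = d has_vector_derivative_cnj has_vector_derivative_add has_vector_derivative_diff
    has_vector_derivative_minus has_vector_derivative_const has_vector_derivative_mult_right
    has_vector_derivative_mult
  note decay = qd quad_decay_add quad_decay_diff quad_decay_minus quad_decay_cnj quad_decay_scale quad_decay_mult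
  let ?F = "\<lambda>t x. q1 t x * cnj (q1 t x) - (q2 t x * cnj (q t x) + q t x * cnj (q2 t x))
              + (3 * s) * ((q t x * cnj (q t x)) * (q t x * cnj (q t x)))"
  let ?A = "\<lambda>t x. m ^ 3 / 2 - (m * s) * (q t x * cnj (q t x)) - s * (q t x * cnj (q1 t x) - q1 t x * cnj (q t x))"
  let ?B = "\<lambda>t x. - q2 t x + m * q1 t x - m\<^sup>2 * q t x + (2 * s) * (q t x * (q t x * cnj (q t x)))"
  let ?C = "\<lambda>t x. s * (- cnj (q2 t x) - m * cnj (q1 t x) - m\<^sup>2 * cnj (q t x)
              + (2 * s) * (cnj (q t x) * (q t x * cnj (q t x))))"
  show ?thesis
  proof (rule that[of p ?F ?A ?C ?B "complex_of_real (m ^ 3 / 2)"])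
    fix t x
    show "(?F t has_vector_derivative (p t x * cnj (q t x) + q t x * cnj (p t x))) (at x)"
      by (rule has_vector_derivative_eq_rhs, (rule deriv)+) (simp add: p algebra_simps)
    show "(?A t has_vector_derivative (q t x * ?C t x - s * cnj (q t x) * ?B t x)) (at x)"
      by (rule has_vector_derivative_eq_rhs, (rule deriv)+) (simp add: p algebra_simps power2_eq_square)
    show "(?B t has_vector_derivative (p t x - m * ?B t x - 2 * q t x * ?A t x)) (at x)"
      by (rule has_vector_derivative_eq_rhs, (rule deriv)+) (simp add: p algebra_simps power2_eq_square power3_eq_cube)
    show "(?C t has_vector_derivative (s * cnj (p t x) + m * ?C t x + 2 * (s * cnj (q t x)) * ?A t x)) (at x)"
      by (rule has_vector_derivative_eq_rhs, (rule deriv)+) (simp add: p algebra_simps power2_eq_square power3_eq_cube)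
    have "quad_decay (\<lambda>x. - ((m * s) * (q t x * cnj (q t x))) - s * (q t x * cnj (q1 t x) - q1 t x * cnj (q t x)))"
      by (intro decay)
    then show "quad_decay (\<lambda>x. ?A t x - complex_of_real (m ^ 3 / 2))" by simp
  qed (intro q decay)+
qed

section \<open>The energy in physical space\<close>

lemma quad_decay_resolvent:
  assumes "m > 0" "quad_decay g"
  shows "quad_decay (resolvent m g)"
proof -
  obtain K where "K \<ge> 0" "\<And>x. cmod (g x) \<le> K / (1 + x\<^sup>2)"
    using quad_decayE[OF assms(2)] by metis
  with resolvent_bound_quad[OF assms(1) quad_decay_continuous[OF assms(2)]]
  have "\<exists>L. \<forall>x. cmod (resolvent m g x) \<le> L / (1 + x\<^sup>2)" by blast
  then show ?thesis
    unfolding quad_decay_def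
    using resolvent_bounded(1)[OF assms(1) quad_decay_continuous quad_decay_bounded] assms(2) by blast
qed

lemma quad_decay_resolvent_derivative:
  assumes "m > 0" "quad_decay g"
  shows "(resolvent m g has_vector_derivative (m * resolvent m g x - g x)) (at x)"
proof -
  obtain K where "\<And>x. cmod (g x) \<le> K" using quad_decayE[OF assms(2)] by metis
  from resolvent_has_derivative[OF assms(1) quad_decay_continuous[OF assms(2)] this]
  show ?thesis by (simp add: scaleR_conv_of_real)
qed

lemma quad_decay_eq_resolvent:
  assumes "m > 0" "quad_decay g" "bounded (range f)"
    and "\<And>x. (f has_vector_derivative (m * f x - g x)) (at x)"
  shows "f = resolvent m g"
proof
  fix x
  obtain K where K: "\<And>x. cmod (g x) \<le> K" using quad_decayE[OF assms(2)] by metis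
  obtain L where L: "\<And>x. cmod (f x) \<le> L" using assms(3) by (auto simp: bounded_iff)
  show "f x = resolvent m g x"
    by (rule eq_resolvent[OF assms(1) _ quad_decay_continuous[OF assms(2)] K L])
       (use assms(4) in \<open>simp add: scaleR_conv_of_real\<close>)
qed

text \<open>The integrand is the derivative of |v|^2. Pointwise identities and inequalities may
  therefore carry a multiple of it as a correction that disappears on integration.\<close>

lemma energy_derivative:
  assumes "quad_decay v" "\<And>x. (v has_vector_derivative v' x) (at x)" "quad_decay v'"
  shows "integrable lborel (\<lambda>x. 2 * Re (v' x * cnj (v x)))"
    and "(LINT x|lborel. 2 * Re (v' x * cnj (v x))) = 0"
proof -
  let ?D = "\<lambda>x. v x * cnj (v' x) + v' x * cnj (v x)"
  have qd: "quad_decay ?D"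
    by (intro quad_decay_add quad_decay_mult quad_decay_cnj assms)
  have Re: "2 * Re (v' x * cnj (v x)) = Re (?D x)" for x by simp
  have "((\<lambda>x. v x * cnj (v x)) has_vector_derivative ?D x) (at x)" for x
    by (rule has_vector_derivative_mult has_vector_derivative_cnj assms)+
  moreover have "quad_decay (\<lambda>x. v x * cnj (v x))"
    by (intro quad_decay_mult quad_decay_cnj assms)
  ultimately have "(LINT x|lborel. ?D x) = 0"
    using qd by (intro integral_of_derivative_eq_0) (auto simp: quad_decay_tendsto)
  then show "(LINT x|lborel. 2 * Re (v' x * cnj (v x))) = 0"
    unfolding Re using quad_decay_integrable[OF qd] by (simp del: plus_complex.simps)
  show "integrable lborel (\<lambda>x. 2 * Re (v' x * cnj (v x)))"
    unfolding Re by (intro integrable_Re quad_decay_integrable qd)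
qed

text \<open>This combines Cauchy-Schwarz with the fact that \<open>resolvent m\<close> has L2
  operator norm at most 1 / m. Both are replaced by one pointwise inequality: the relation V' = m V
  - g bounds m |V|^2 by |g| |V| plus half the derivative of |V|^2, and AM-GM does the rest.\<close>

lemma L2_pairing_bound:
  assumes "m > 0" "quad_decay q" "quad_decay g" "\<And>x. cmod (g x) \<le> R * cmod (q x)" "R > 0"
  shows "cmod (LINT x|lborel. q x * resolvent m g x) \<le> R * (L2norm q)\<^sup>2 / m"
proof -
  define V where "V = resolvent m g"
  define V' where "V' = (\<lambda>x. m * V x - g x)"
  have V: "quad_decay V" unfolding V_def by (rule quad_decay_resolvent[OF assms(1,3)])
  have dV: "(V has_vector_derivative V' x) (at x)" for x
    unfolding V_def V'_def by (rule quad_decay_resolvent_derivative[OF assms(1,3)])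
  have qV': "quad_decay V'"
    unfolding V'_def by (intro quad_decay_diff quad_decay_scale V assms)
  note D = energy_derivative[OF V dV qV']
  have pt: "cmod (q x * V x) \<le> R / m * (cmod (q x))\<^sup>2 + 1 / (2 * R) * (2 * Re (V' x * cnj (V x)))" for x
  proof -
    define a b d where "a = cmod (q x)" and "b = cmod (V x)" and "d = 2 * Re (V' x * cnj (V x))"
    have "Re (V x * cnj (V x)) = b\<^sup>2" by (simp add: b_def flip: complex_norm_square)
    then have d: "d = 2 * m * b\<^sup>2 - 2 * Re (g x * cnj (V x))"
      unfolding d_def V'_def by (simp add: algebra_simps)
    have "Re (g x * cnj (V x)) \<le> cmod (g x) * b"
      using complex_Re_le_cmod[of "g x * cnj (V x)"] by (simp add: norm_mult b_def)
    also have "\<dots> \<le> (R * a) * b"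
      using assms(4) by (intro mult_right_mono) (auto simp: a_def b_def)
    finally have 1: "2 * m * b\<^sup>2 \<le> d + 2 * R * a * b" using d by simp
    have "0 \<le> (R * a - m * b)\<^sup>2" by simp
    then have 2: "2 * R * a * (m * b) \<le> R\<^sup>2 * a\<^sup>2 + m * (m * b\<^sup>2)"
      by (simp add: power2_eq_square algebra_simps)
    have "m * (2 * m * b\<^sup>2) \<le> m * (d + 2 * R * a * b)"
      using 1 assms(1) by (intro mult_left_mono) auto
    with 2 have 3: "m * (m * b\<^sup>2) \<le> m * d + R\<^sup>2 * a\<^sup>2" by (simp add: algebra_simps)
    with 2 have "2 * R * a * (m * b) \<le> 2 * R\<^sup>2 * a\<^sup>2 + m * d" by simp
    also have "2 * R\<^sup>2 * a\<^sup>2 + m * d = (2 * R * m) * (R / m * a\<^sup>2 + 1 / (2 * R) * d)"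
      using assms(1,5) by (simp add: field_simps power2_eq_square)
    finally have "(2 * R * m) * (a * b) \<le> (2 * R * m) * (R / m * a\<^sup>2 + 1 / (2 * R) * d)"
      by (simp add: mult_ac)
    then have "a * b \<le> R / m * a\<^sup>2 + 1 / (2 * R) * d"
      using assms(1,5) by (subst (asm) mult_le_cancel_left_pos) auto
    then show ?thesis by (simp add: a_def b_def d_def norm_mult)
  qed
  have "cmod (LINT x|lborel. q x * V x) \<le> (LINT x|lborel. cmod (q x * V x))"
    by (rule integral_norm_bound)
  also have "\<dots> \<le> (LINT x|lborel. R / m * (cmod (q x))\<^sup>2 + 1 / (2 * R) * (2 * Re (V' x * cnj (V x))))"
    by (intro integral_mono pt integrable_norm quad_decay_integrable quad_decay_mult V assms
          Bochner_Integration.integrable_add integrable_mult_right quad_decay_integrable_sq D)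
  also have "\<dots> = (LINT x|lborel. R / m * (cmod (q x))\<^sup>2) + (LINT x|lborel. 1 / (2 * R) * (2 * Re (V' x * cnj (V x))))"
    by (intro Bochner_Integration.integral_add integrable_mult_right quad_decay_integrable_sq assms D)
  also have "\<dots> = R / m * (L2norm q)\<^sup>2 + 1 / (2 * R) * 0"
    unfolding L2norm_sq by (subst (1 2) integral_mult_right_zero) (simp only: D(2))
  finally show ?thesis by (simp add: V_def)
qed

text \<open>The resolvent commutes with differentiation, so \<open>resolvent m q'\<close> equals f =
  m v - q with v = resolvent m q. Expanding |f|^2 and using that f is also v', the leftover term is
  a multiple of the derivative of |v|^2.\<close>

lemma resolvent_energy_identity:
  assumes "m > 0" and q: "quad_decay q" "quad_decay q'" "\<And>x. (q has_vector_derivative q' x) (at x)"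
  shows "(L2norm (resolvent m q'))\<^sup>2 = (L2norm q)\<^sup>2 - m * Re (LINT x|lborel. q x * cnj (resolvent m q x))"
proof -
  define v where "v = resolvent m q"
  define f where "f = (\<lambda>x. m * v x - q x)"
  have v: "quad_decay v" unfolding v_def by (rule quad_decay_resolvent[OF assms(1,2)])
  have dv: "(v has_vector_derivative f x) (at x)" for x
    unfolding v_def f_def by (rule quad_decay_resolvent_derivative[OF assms(1,2)])
  have qf: "quad_decay f"
    unfolding f_def by (intro quad_decay_diff quad_decay_scale v assms)
  have "f = resolvent m q'"
  proof (rule quad_decay_eq_resolvent[OF assms(1,3) quad_decay_bounded[OF qf]])
    show "(f has_vector_derivative (m * f x - q' x)) (at x)" for x
      unfolding f_def[abs_def]
      by (rule has_vector_derivative_diff has_vector_derivative_mult_right dv[unfolded f_def] q(3))+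
  qed
  note D = energy_derivative[OF v dv qf]
  have pt: "(cmod (f x))\<^sup>2 = (cmod (q x))\<^sup>2 - m * Re (q x * cnj (v x)) + m / 2 * (2 * Re (f x * cnj (v x)))" for x
  proof -
    have qx: "q x = m * v x - f x" by (simp add: f_def)
    show ?thesis unfolding qx
      by (simp add: cmod_power2) (simp add: power2_eq_square algebra_simps)
  qed
  have i: "integrable lborel (\<lambda>x. q x * cnj (v x))"
    by (intro quad_decay_integrable quad_decay_mult quad_decay_cnj q v)
  have iq: "integrable lborel (\<lambda>x. (cmod (q x))\<^sup>2)" by (rule quad_decay_integrable_sq[OF q(1)])
  have iv: "integrable lborel (\<lambda>x. m * Re (q x * cnj (v x)))" by (intro integrable_mult_right integrable_Re i)
  have "(L2norm f)\<^sup>2 = (LINT x|lborel. (cmod (q x))\<^sup>2 - m * Re (q x * cnj (v x)) + m / 2 * (2 * Re (f x * cnj (v x))))"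
    unfolding L2norm_sq pt ..
  also have "\<dots> = (LINT x|lborel. (cmod (q x))\<^sup>2 - m * Re (q x * cnj (v x)))
      + (LINT x|lborel. m / 2 * (2 * Re (f x * cnj (v x))))"
    by (intro Bochner_Integration.integral_add Bochner_Integration.integrable_diff iq iv integrable_mult_right D(1))
  also have "(LINT x|lborel. m / 2 * (2 * Re (f x * cnj (v x)))) = 0"
    by (subst integral_mult_right_zero) (simp only: D(2) mult_zero_right)
  also have "(LINT x|lborel. (cmod (q x))\<^sup>2 - m * Re (q x * cnj (v x)))
      = (L2norm q)\<^sup>2 - m * (LINT x|lborel. Re (q x * cnj (v x)))"
    unfolding Bochner_Integration.integral_diff[OF iq iv] L2norm_sq by (simp only: integral_mult_right_zero)
  also have "(LINT x|lborel. Re (q x * cnj (v x))) = Re (LINT x|lborel. q x * cnj (v x))"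
    by (rule integral_Re[OF i])
  finally show ?thesis unfolding \<open>f = resolvent m q'\<close> by (simp add: v_def)
qed

text \<open>To first order \<open>u\<close> is - s cnj v, so the energy identity expresses the
  left-hand energy through the integral of q u. The remainder V is the resolvent of q u^2, whose
  size is at most (2 c)^2 |q|; its pairing with \<open>q\<close> is at most 2 |q|^4 / m^2 in terms
  of the L2 norm, and the identity multiplies it by \<open>m\<close>.\<close>

lemma riccati_energy_estimate:
  fixes s m :: real
  assumes "m > 0" "\<bar>s\<bar> = 1" and q: "quad_decay q" "quad_decay q'" "\<And>x. (q has_vector_derivative q' x) (at x)"
    and c: "c = L2norm q / sqrt (2 * m)"
    and u: "\<And>x. (u has_vector_derivative (m *\<^sub>R u x - (q x * (u x)\<^sup>2 - s * cnj (q x)))) (at x)"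
      "\<And>x. cmod (u x) \<le> 2 * c"
  shows "\<bar>(L2norm (resolvent m q'))\<^sup>2 - ((L2norm q)\<^sup>2 + m * s * Re (LINT x|lborel. q x * u x))\<bar> \<le> 2 * L2norm q ^ 4 / m"
proof -
  define v where "v = resolvent m q"
  define g where "g = (\<lambda>x. q x * (u x)\<^sup>2)"
  \<comment> \<open>the part of \<open>u\<close> that is of higher order in \<open>q\<close>\<close>
  define V where "V = (\<lambda>x. u x + s * cnj (v x))"
  have v: "quad_decay v" unfolding v_def by (rule quad_decay_resolvent[OF assms(1) q(1)])
  have dv: "(v has_vector_derivative (m * v x - q x)) (at x)" for x
    unfolding v_def by (rule quad_decay_resolvent_derivative[OF assms(1) q(1)])
  have uc: "continuous_on UNIV u"
    using u(1) by (meson continuous_at_imp_continuous_on has_vector_derivative_continuous)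
  have c0: "c \<ge> 0" unfolding c L2norm_def using assms(1) by (simp add: integral_nonneg_AE)
  have u2: "cmod ((u x)\<^sup>2) \<le> (2 * c)\<^sup>2" for x
    unfolding norm_power using u(2) by (intro power_mono) auto
  have g: "quad_decay g"
    unfolding g_def by (intro quad_decay_mult_bounded[OF q(1) _ u2] continuous_intros uc)
  have ub: "bounded (range u)" using u(2) by (auto simp: bounded_iff)
  have "V = resolvent m g"
  proof (rule quad_decay_eq_resolvent[OF assms(1) g])
    show "bounded (range V)"
      unfolding V_def by (intro bounded_plus_comp ub quad_decay_bounded quad_decay_scale quad_decay_cnj v)
    show "(V has_vector_derivative (m * V x - g x)) (at x)" for x
      unfolding V_def[abs_def]
      by (rule has_vector_derivative_eq_rhs, (rule has_vector_derivative_add has_vector_derivative_mult_right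
            has_vector_derivative_cnj dv u)+) (simp add: g_def scaleR_conv_of_real algebra_simps)
  qed
  have "cmod (LINT x|lborel. q x * V x) \<le> (2 * c)\<^sup>2 * (L2norm q)\<^sup>2 / m"
  \<comment> \<open>The pairing bound requires a positive constant, so \<open>c = 0\<close>, where
    \<open>u\<close> and hence \<open>g\<close> vanish, is separate.\<close>
  proof (cases "c = 0")
    case True
    then have "g = (\<lambda>x. 0)" using u(2) by (auto simp: g_def)
    then show ?thesis using \<open>V = resolvent m g\<close> assms(1) by (simp add: resolvent_def)
  next
    case False
    have "cmod (g x) \<le> (2 * c)\<^sup>2 * cmod (q x)" for x
      using mult_right_mono[OF u2[of x] norm_ge_zero[of "q x"]] by (simp add: g_def norm_mult mult.commute)
    then show ?thesis unfolding \<open>V = resolvent m g\<close>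
      using False by (intro L2_pairing_bound assms(1) q g) auto
  qed
  also have "(2 * c)\<^sup>2 * (L2norm q)\<^sup>2 / m = 2 * L2norm q ^ 4 / m / m"
    using assms(1) by (simp add: c power_divide power2_eq_square power4_eq_xxxx field_simps)
  finally have bound: "cmod (LINT x|lborel. q x * V x) \<le> 2 * L2norm q ^ 4 / m / m" .
  have qu: "quad_decay (\<lambda>x. q x * u x)" by (rule quad_decay_mult_bounded[OF q(1) uc u(2)])
  have qv: "quad_decay (\<lambda>x. q x * cnj (v x))" by (intro quad_decay_mult quad_decay_cnj q v)
  have "(LINT x|lborel. q x * V x) = (LINT x|lborel. q x * u x + s * (q x * cnj (v x)))"
    by (simp add: V_def algebra_simps)
  also have "\<dots> = (LINT x|lborel. q x * u x) + s * (LINT x|lborel. q x * cnj (v x))"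
    using quad_decay_integrable[OF qu] quad_decay_integrable[OF qv] by simp
  finally have "Re (LINT x|lborel. q x * V x) = Re (LINT x|lborel. q x * u x) + s * Re (LINT x|lborel. q x * cnj (v x))"
    by simp
  moreover have "s * s = 1" using assms(2) by (metis abs_mult_self_eq mult_1)
  ultimately have eq: "Re (LINT x|lborel. q x * cnj (v x)) = s * (Re (LINT x|lborel. q x * V x) - Re (LINT x|lborel. q x * u x))"
    by (simp add: algebra_simps flip: mult.assoc)
  have "(L2norm (resolvent m q'))\<^sup>2 - ((L2norm q)\<^sup>2 + m * s * Re (LINT x|lborel. q x * u x))
     = - (m * s * Re (LINT x|lborel. q x * V x))"
    unfolding resolvent_energy_identity[OF assms(1) q] v_def[symmetric] eq by (simp add: algebra_simps)
  also have "\<bar>\<dots>\<bar> = m * \<bar>Re (LINT x|lborel. q x * V x)\<bar>"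
    using assms(1,2) by (simp add: abs_mult)
  also have "\<dots> \<le> m * (2 * L2norm q ^ 4 / m / m)"
    using assms(1) order_trans[OF abs_Re_le_cmod bound] by (intro mult_left_mono) auto
  finally show ?thesis using assms(1) by simp
qed

text \<open>The quantity approximating the energy consists of the mass and the integral of q u, both
  conserved. It cancels between the estimates at times t and 0, whose errors 2 |q(0)|^4 / m add up
  to the constant 4.\<close>

lemma zero_curvature_energy:
  fixes q p A B C F :: "real \<Rightarrow> real \<Rightarrow> complex" and s m :: real
  assumes s: "\<bar>s\<bar> = 1" and m: "m \<ge> 2" and small: "L2norm (q 0) \<le> 1 / 2" and q: "schwartz_curve q p" and
    F: "\<And>t x. (F t has_vector_derivative (p t x * cnj (q t x) + q t x * cnj (p t x))) (at x)"
    "\<And>t. quad_decay (F t)" and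
    A: "\<And>t x. (A t has_vector_derivative (q t x * C t x - s * cnj (q t x) * B t x)) (at x)"
    "\<And>t. quad_decay (\<lambda>x. A t x - a)" and
    B: "\<And>t x. (B t has_vector_derivative (p t x - m * B t x - 2 * q t x * A t x)) (at x)"
    "\<And>t. quad_decay (B t)" and
    C: "\<And>t x. (C t has_vector_derivative (s * cnj (p t x) + m * C t x + 2 * (s * cnj (q t x)) * A t x)) (at x)"
    "\<And>t. quad_decay (C t)"
  shows "(L2norm (resolvent m (xderiv (q t))))\<^sup>2
    \<le> (L2norm (resolvent m (xderiv (q 0))))\<^sup>2 + 4 * L2norm (q 0) ^ 4 / m"
proof -
  have m0: "m > 0" using m by simp
  define c where "c = L2norm (q 0) / sqrt (2 * m)"
  have N: "L2norm (q t) = L2norm (q 0)" for t by (rule L2norm_conserved[OF q F])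
  have cN: "c = L2norm (q t) / sqrt (2 * m)" for t by (simp add: c_def N[of t])
  \<comment> \<open>For \<open>m \<ge> 2\<close> the denominator of \<open>c\<close> is at least 2,
    so the bound 1/2 on the L2 norm gives the threshold 1/4 needed for the Riccati equation.\<close>
  have "sqrt (2\<^sup>2) \<le> sqrt (2 * m)" using m by (intro real_sqrt_le_mono) auto
  then have "c \<le> (1 / 2) / 2"
    unfolding c_def using small by (intro frac_le) (auto simp: L2norm_def integral_nonneg_AE)
  then have c4: "c \<le> 1 / 4" by simp
  have "\<exists>u. (\<forall>x. (u has_vector_derivative (m *\<^sub>R u x - (q t x * (u x)\<^sup>2 - s * cnj (q t x)))) (at x))
      \<and> (\<forall>x. cmod (u x) \<le> 2 * c)" for t
  proof (rule riccati_solution[OF m0 schwartz_curve_quad_decay(1)[OF q] _ _ cN c4])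
    show "quad_decay (\<lambda>x. s * cnj (q t x))"
      by (intro quad_decay_scale quad_decay_cnj schwartz_curve_quad_decay[OF q])
    show "cmod (s * cnj (q t x)) \<le> cmod (q t x)" for x using s by (simp add: norm_mult)
  qed blast
  \<comment> \<open>The solution is chosen separately at each time. No regularity in
    \<open>t\<close> is assumed in this choice; differentiability follows from the stability of the
    Riccati equation.\<close>
  then obtain u where u: "\<And>t x. (u t has_vector_derivative (m *\<^sub>R u t x - (q t x * (u t x)\<^sup>2 - s * cnj (q t x)))) (at x)"
    "\<And>t x. cmod (u t x) \<le> 2 * c" by metis
  have cons: "(LINT x|lborel. q t x * u t x) = (LINT x|lborel. q 0 x * u 0 x)" for t
    by (rule zero_curvature_conservation[OF q s m0 cN c4 u A B C])
  have est: "\<bar>(L2norm (resolvent m (xderiv (q t))))\<^sup>2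
      - ((L2norm (q 0))\<^sup>2 + m * s * Re (LINT x|lborel. q 0 x * u 0 x))\<bar> \<le> 2 * L2norm (q 0) ^ 4 / m" for t
    using riccati_energy_estimate[OF m0 s _ _ _ cN[of t] u(1)[of t] u(2)[of t], of "xderiv (q t)"]
      schwartz_curve_derivs[OF q, of 0 t] schwartz_curve_derivs[OF q, of 1 t]
    by (simp add: N[of t] cons[of t])
  from est[of t] est[of 0] show ?thesis by (simp add: abs_le_iff)
qed

lemma solution_energy:
  assumes "s \<in> {1, - 1 :: real}" "nls_solution s q \<or> mkdv_solution s q" "L2norm (q 0) \<le> 1 / 2" "m \<ge> 2"
  shows "(L2norm (resolvent m (xderiv (q t))))\<^sup>2
    \<le> (L2norm (resolvent m (xderiv (q 0))))\<^sup>2 + 4 * L2norm (q 0) ^ 4 / m"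
proof -
  have s: "\<bar>s\<bar> = 1" using assms(1) by auto
  note * = zero_curvature_energy[where q = q, OF s assms(4,3)]
  from assms(2) show ?thesis
  proof
    assume "nls_solution s q"
    then show ?thesis by (rule nls_zero_curvature[where m = m]) (rule *)
  next
    assume "mkdv_solution s q"
    then show ?thesis by (rule mkdv_zero_curvature[where m = m]) (rule *)
  qed
qed

lemma solution_schwartz:
  assumes "nls_solution s q \<or> mkdv_solution s q"
  shows "q t \<in> schwartz"
  using assms by (auto simp: nls_solution_def mkdv_solution_def schwartz_curve_def)

section \<open>The energy in frequency space\<close>

text \<open>The symmetric form in which Fubini is used for Plancherel: a kernel of modulus at most
  1, such as a character, is transposed from one integrable function to the other.\<close>

lemma lborel_Fubini_kernel:
  fixes a b :: "real \<Rightarrow> complex" and k :: "real \<Rightarrow> real \<Rightarrow> complex"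
  assumes a: "integrable lborel a" and b: "integrable lborel b"
    and k[measurable]: "case_prod k \<in> borel_measurable (borel \<Otimes>\<^sub>M borel)"
    and k1: "\<And>x y. cmod (k x y) \<le> 1"
  shows "(LINT x|lborel. a x * (LINT y|lborel. k x y * b y)) = (LINT y|lborel. b y * (LINT x|lborel. k x y * a x))"
proof -
  have [measurable]: "a \<in> borel_measurable borel" "b \<in> borel_measurable borel"
    using a b by (auto dest: borel_measurable_integrable)
  let ?f = "\<lambda>x y. a x * (k x y * b y)"
  have kb: "integrable lborel (\<lambda>y. k x y * b y)" for x
    by (rule Bochner_Integration.integrable_bound[OF b])
       (auto simp: norm_mult intro!: AE_I2 mult_left_le_one_le k1)
  have i: "integrable (lborel \<Otimes>\<^sub>M lborel) (case_prod ?f)"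
  proof (rule lborel_pair.Fubini_integrable)
    have le: "(LINT y|lborel. cmod (k x y * b y)) \<le> (LINT y|lborel. cmod (b y))" for x
      by (intro integral_mono integrable_norm kb b) (auto simp: norm_mult intro!: mult_left_le_one_le k1)
    have eq: "(LINT y|lborel. cmod (case_prod ?f (x, y))) = cmod (a x) * (LINT y|lborel. cmod (k x y * b y))" for x
      by (simp add: norm_mult)
    show "integrable lborel (\<lambda>x. LINT y|lborel. cmod (case_prod ?f (x, y)))"
      unfolding eq
    proof (rule Bochner_Integration.integrable_bound[OF integrable_mult_left[OF integrable_norm[OF a], of "LINT y|lborel. cmod (b y)"]])
      show "AE x in lborel. norm (cmod (a x) * (LINT y|lborel. cmod (k x y * b y)))
          \<le> norm (cmod (a x) * (LINT y|lborel. cmod (b y)))"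
        by (intro AE_I2) (auto simp: abs_mult integral_nonneg_AE intro!: mult_left_mono le)
    qed measurable
    show "AE x in lborel. integrable lborel (\<lambda>y. case_prod ?f (x, y))"
      using kb by (auto intro!: AE_I2 integrable_mult_right)
  qed measurable
  have "(LINT x|lborel. a x * (LINT y|lborel. k x y * b y)) = (LINT x|lborel. LINT y|lborel. ?f x y)"
    by simp
  also have "\<dots> = (LINT y|lborel. LINT x|lborel. ?f x y)"
    by (rule lborel_pair.Fubini_integral[OF i, symmetric])
  also have "\<dots> = (LINT y|lborel. LINT x|lborel. b y * (k x y * a x))"
    by (simp add: mult_ac)
  finally show ?thesis by simp
qed

lemma fourier_measurable:
  assumes "quad_decay f"
  shows "fourier f \<in> borel_measurable borel"
proof -
  note [measurable] = quad_decay_measurable[OF assms]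
  have [measurable]: "(\<lambda>z. cis (- (fst z * snd z))) \<in> borel_measurable (borel \<Otimes>\<^sub>M lborel)"
    unfolding cis_conv_exp by measurable
  have "(\<lambda>\<xi>. LINT x|lborel. cis (- (\<xi> * x)) * f x) \<in> borel_measurable borel"
    by measurable
  then show ?thesis
    unfolding fourier_def by measurable
qed

lemma fourier_bounded:
  assumes "quad_decay f"
  shows "cmod (fourier f \<xi>) \<le> 1 / sqrt (2 * pi) * (LINT x|lborel. cmod (f x))"
proof -
  have "cmod (LINT x|lborel. cis (- (\<xi> * x)) * f x) \<le> (LINT x|lborel. cmod (cis (- (\<xi> * x)) * f x))"
    by (rule integral_norm_bound)
  then show ?thesis by (simp add: fourier_def norm_mult norm_divide divide_right_mono)
qed

text \<open>The derivative of v(x) exp (- i \<xi> x), with v the resolvent of \<open>g\<close>,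
  integrates to 0; this identifies m - i \<xi> as the symbol inverted by the resolvent.\<close>

lemma fourier_resolvent:
  assumes "m > 0" "quad_decay g"
  shows "(m - \<i> * \<xi>) * fourier (resolvent m g) \<xi> = fourier g \<xi>"
proof -
  define v where "v = resolvent m g"
  have v: "quad_decay v" unfolding v_def by (rule quad_decay_resolvent[OF assms])
  have dv: "(v has_vector_derivative (m * v x - g x)) (at x)" for x
    unfolding v_def by (rule quad_decay_resolvent_derivative[OF assms])
  let ?e = "\<lambda>x. cis (- (\<xi> * x))"
  have de: "(?e has_vector_derivative (- \<i> * \<xi>) * ?e x) (at x)" for x
    using exp_scaleR_has_vector_derivative_right[of "- \<i> * \<xi>" x UNIV]
    by (simp add: cis_conv_exp scaleR_conv_of_real mult_ac)
  have ce: "continuous_on UNIV ?e" unfolding cis_conv_exp by (intro continuous_intros)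
  have qd: "quad_decay (\<lambda>x. f x * ?e x)" if "quad_decay f" for f
    by (rule quad_decay_mult_bounded[OF that ce, of 1]) simp
  have "(LINT x|lborel. (m - \<i> * \<xi>) * (v x * ?e x) - g x * ?e x) = 0"
  proof (rule integral_of_derivative_eq_0)
    show "((\<lambda>x. v x * ?e x) has_vector_derivative ((m - \<i> * \<xi>) * (v x * ?e x) - g x * ?e x)) (at x)" for x
      by (rule has_vector_derivative_eq_rhs[OF has_vector_derivative_mult[OF dv de]]) (simp add: algebra_simps)
    show "quad_decay (\<lambda>x. (m - \<i> * \<xi>) * (v x * ?e x) - g x * ?e x)"
      by (intro quad_decay_diff quad_decay_scale qd v assms)
  qed (use quad_decay_tendsto[OF qd[OF v]] in auto)
  then have "(m - \<i> * \<xi>) * (LINT x|lborel. v x * ?e x) = (LINT x|lborel. g x * ?e x)"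
    using quad_decay_integrable[OF qd[OF v]] quad_decay_integrable[OF qd[OF assms(2)]] by simp
  then show ?thesis
    by (simp add: fourier_def v_def mult.commute[of "cis _"] mult.left_commute)
qed

section \<open>Plancherel's theorem by Gaussian regularisation\<close>

lemma gaussian_fourier:
  assumes "\<epsilon> > 0"
  shows "(LINT \<xi>|lborel. complex_of_real (exp (- (\<epsilon> * \<xi>)\<^sup>2 / 2)) * cis (\<xi> * w)) = 2 * pi / \<epsilon> * std_normal_density (w / \<epsilon>)"
proof -
  have [measurable]: "(\<lambda>x. cis (a * x)) \<in> borel_measurable borel" for a
    unfolding cis_conv_exp by measurable
  \<comment> \<open>The Gaussian integral is read off from the characteristic function of the normal
    distribution at w / \<epsilon> after the substitution of \<epsilon> x for x.\<close>
  have "exp (- (w / \<epsilon>)\<^sup>2 / 2) = char std_normal_distribution (w / \<epsilon>)"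
    by (simp add: char_std_normal_distribution)
  also have "\<dots> = (LINT x|lborel. std_normal_density x *\<^sub>R cis (w / \<epsilon> * x))"
    unfolding char_def cis_conv_exp[symmetric]
    by (rule integral_density) (auto intro!: borel_measurable_continuous_onI continuous_intros simp: cis_conv_exp)
  also have "\<dots> = \<bar>\<epsilon>\<bar> *\<^sub>R (LINT x|lborel. std_normal_density (0 + \<epsilon> * x) *\<^sub>R cis (w / \<epsilon> * (0 + \<epsilon> * x)))"
    by (rule lborel_integral_real_affine) (use assms in simp)
  also have "\<dots> = \<epsilon> *\<^sub>R (LINT x|lborel. (1 / sqrt (2 * pi)) * (complex_of_real (exp (- (\<epsilon> * x)\<^sup>2 / 2)) * cis (x * w)))"
    using assms by (simp add: std_normal_density_def scaleR_conv_of_real mult_ac)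
  also have "\<dots> = complex_of_real (\<epsilon> / sqrt (2 * pi)) * (LINT x|lborel. complex_of_real (exp (- (\<epsilon> * x)\<^sup>2 / 2)) * cis (x * w))"
    by (subst integral_mult_right_zero) (simp add: scaleR_conv_of_real)
  finally have *: "complex_of_real (exp (- (w / \<epsilon>)\<^sup>2 / 2)) = complex_of_real (\<epsilon> / sqrt (2 * pi)) * (LINT x|lborel. complex_of_real (exp (- (\<epsilon> * x)\<^sup>2 / 2)) * cis (x * w))" .
  have k: "complex_of_real (sqrt (2 * pi) / \<epsilon>) * complex_of_real (\<epsilon> / sqrt (2 * pi)) = 1"
    using assms by (simp flip: of_real_mult)
  have "(LINT \<xi>|lborel. complex_of_real (exp (- (\<epsilon> * \<xi>)\<^sup>2 / 2)) * cis (\<xi> * w))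
      = complex_of_real (sqrt (2 * pi) / \<epsilon>) * (complex_of_real (\<epsilon> / sqrt (2 * pi)) * (LINT x|lborel. complex_of_real (exp (- (\<epsilon> * x)\<^sup>2 / 2)) * cis (x * w)))"
    by (simp only: mult.assoc[symmetric] k mult_1)
  also have "\<dots> = complex_of_real (sqrt (2 * pi) / \<epsilon> * exp (- (w / \<epsilon>)\<^sup>2 / 2))"
    unfolding *[symmetric] by simp
  also have "sqrt (2 * pi) / \<epsilon> * exp (- (w / \<epsilon>)\<^sup>2 / 2) = 2 * pi / \<epsilon> * std_normal_density (w / \<epsilon>)"
  proof -
    have "sqrt (2 * pi) = 2 * pi / sqrt (2 * pi)" by (simp add: real_div_sqrt)
    then have "sqrt (2 * pi) / \<epsilon> = 2 * pi / \<epsilon> * (1 / sqrt (2 * pi))"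
      by (metis mult.commute mult.right_neutral times_divide_eq_left times_divide_eq_right)
    then show ?thesis unfolding std_normal_density_def by (simp only: mult.assoc)
  qed
  finally show ?thesis .
qed

lemma gaussian_integrable:
  assumes "\<epsilon> \<noteq> 0"
  shows "integrable lborel (\<lambda>\<xi>::real. exp (- (\<epsilon> * \<xi>)\<^sup>2 / 2))"
proof -
  have "integrable lborel (\<lambda>x. std_normal_density (0 + \<epsilon> * x))"
    by (rule lborel_integrable_real_affine[OF _ assms]) (simp add: integrable_normal_density)
  from integrable_mult_right[OF this, of "sqrt (2 * pi)"] show ?thesis
    by (simp add: std_normal_density_def)
qed

text \<open>The Gaussian factor makes the integrals absolutely convergent, so Fubini applies twice.
  Integrating in \<xi> first turns it into a normal density of width \<epsilon>, and the right side
  pairs \<open>f\<close> with its convolution with an approximate identity.\<close>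

lemma gaussian_regularised_plancherel:
  fixes f :: "real \<Rightarrow> complex"
  assumes f: "quad_decay f" and "\<epsilon> > 0"
  shows "(LINT \<xi>|lborel. exp (- (\<epsilon> * \<xi>)\<^sup>2 / 2) * (cmod (fourier f \<xi>))\<^sup>2)
       = (LINT y|lborel. cnj (f y) * (LINT z|lborel. f (y - \<epsilon> * z) * std_normal_density z))"
proof -
  note [measurable] = quad_decay_measurable[OF f] fourier_measurable[OF f]
  define e where "e = (\<lambda>\<xi>::real. complex_of_real (exp (- (\<epsilon> * \<xi>)\<^sup>2 / 2)))"
  define c where "c = complex_of_real (1 / sqrt (2 * pi))"
  have cc: "c * c = complex_of_real (1 / (2 * pi))"
    unfolding c_def by (simp flip: of_real_mult)
  have ei: "integrable lborel e"
    unfolding e_def by (intro integrable_of_real gaussian_integrable) (use assms in simp)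
  have fi: "integrable lborel f" by (rule quad_decay_integrable[OF f])
  have efi: "integrable lborel (\<lambda>\<xi>. e \<xi> * (LINT x|lborel. cis (- (\<xi> * x)) * f x))"
  proof -
    have F: "(LINT x|lborel. cis (- (\<xi> * x)) * f x) = sqrt (2 * pi) * fourier f \<xi>" for \<xi>
      by (simp add: fourier_def flip: mult.assoc of_real_mult)
    have "integrable lborel (\<lambda>\<xi>. e \<xi> * (sqrt (2 * pi) * fourier f \<xi>))"
    proof (rule Bochner_Integration.integrable_bound[OF integrable_mult_left[OF ei]])
      show "AE \<xi> in lborel. cmod (e \<xi> * (sqrt (2 * pi) * fourier f \<xi>))
          \<le> cmod (e \<xi> * complex_of_real (LINT x|lborel. cmod (f x)))"
      proof (rule AE_I2)
        fix \<xi>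
        have "sqrt (2 * pi) * cmod (fourier f \<xi>) \<le> (LINT x|lborel. cmod (f x))"
          using fourier_bounded[OF f, of \<xi>] by (simp add: field_simps)
        then show "cmod (e \<xi> * (sqrt (2 * pi) * fourier f \<xi>))
          \<le> cmod (e \<xi> * complex_of_real (LINT x|lborel. cmod (f x)))"
          by (simp add: norm_mult mult_left_mono)
      qed
    qed (simp add: e_def)
    then show ?thesis unfolding F .
  qed
  have km: "case_prod (\<lambda>x y. cis (x * y)) \<in> borel_measurable (borel \<Otimes>\<^sub>M borel)"
    "case_prod (\<lambda>x y. cis (- (x * y))) \<in> borel_measurable (borel \<Otimes>\<^sub>M borel)"
    unfolding cis_conv_exp by measurable
  have inner: "(LINT \<xi>|lborel. cis (\<xi> * y) * (e \<xi> * (LINT x|lborel. cis (- (\<xi> * x)) * f x)))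
      = 2 * pi * (LINT z|lborel. f (y - \<epsilon> * z) * std_normal_density z)" for y
  proof -
    have i: "integrable lborel (\<lambda>\<xi>. cis (\<xi> * y) * e \<xi>)"
      by (rule Bochner_Integration.integrable_bound[OF ei])
         (auto simp: norm_mult e_def cis_conv_exp intro!: AE_I2)
    have "(LINT \<xi>|lborel. cis (\<xi> * y) * (e \<xi> * (LINT x|lborel. cis (- (\<xi> * x)) * f x)))
        = (LINT \<xi>|lborel. (cis (\<xi> * y) * e \<xi>) * (LINT x|lborel. cis (- (\<xi> * x)) * f x))"
      by (simp only: mult.assoc)
    also have "\<dots> = (LINT x|lborel. f x * (LINT \<xi>|lborel. cis (- (\<xi> * x)) * (cis (\<xi> * y) * e \<xi>)))"
      by (rule lborel_Fubini_kernel[OF i fi km(2)]) simp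
    also have "\<dots> = (LINT x|lborel. f x * (2 * pi / \<epsilon> * std_normal_density ((y - x) / \<epsilon>)))"
    proof -
      have "(LINT \<xi>|lborel. cis (- (\<xi> * x)) * (cis (\<xi> * y) * e \<xi>)) = (LINT \<xi>|lborel. complex_of_real (exp (- (\<epsilon> * \<xi>)\<^sup>2 / 2)) * cis (\<xi> * (y - x)))" for x
        by (simp add: e_def cis_mult algebra_simps flip: mult.assoc)
      then show ?thesis unfolding gaussian_fourier[OF assms(2)] by simp
    qed
    also have "\<dots> = \<bar>- \<epsilon>\<bar> *\<^sub>R (LINT z|lborel. f (y + - \<epsilon> * z) * (2 * pi / \<epsilon> * std_normal_density ((y - (y + - \<epsilon> * z)) / \<epsilon>)))"
      by (rule lborel_integral_real_affine) (use assms in simp)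
    also have "\<dots> = complex_of_real \<epsilon> * (LINT z|lborel. (2 * pi / \<epsilon>) * (f (y - \<epsilon> * z) * std_normal_density z))"
      using assms by (simp add: scaleR_conv_of_real mult_ac)
    also have "\<dots> = 2 * pi * (LINT z|lborel. f (y - \<epsilon> * z) * std_normal_density z)"
      using assms by (subst integral_mult_right_zero) simp
    finally show ?thesis .
  qed
  have cnj: "cnj (fourier f \<xi>) = c * (LINT y|lborel. cis (\<xi> * y) * cnj (f y))" for \<xi>
  proof -
    have "cnj (LINT x|lborel. cis (- (\<xi> * x)) * f x) = (LINT x|lborel. cnj (cis (- (\<xi> * x)) * f x))"
      by (rule Bochner_Integration.integral_cnj[symmetric])
    also have "\<dots> = (LINT y|lborel. cis (\<xi> * y) * cnj (f y))"
      by (simp only: complex_cnj_mult cis_cnj minus_minus)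
    finally show ?thesis by (simp only: fourier_def c_def complex_cnj_mult complex_cnj_complex_of_real)
  qed
  have "complex_of_real (LINT \<xi>|lborel. exp (- (\<epsilon> * \<xi>)\<^sup>2 / 2) * (cmod (fourier f \<xi>))\<^sup>2)
      = (LINT \<xi>|lborel. e \<xi> * (fourier f \<xi> * cnj (fourier f \<xi>)))"
    unfolding e_def complex_norm_square[symmetric] of_real_mult[symmetric] integral_complex_of_real ..
  also have "\<dots> = (LINT \<xi>|lborel. (c * c) * ((e \<xi> * (LINT x|lborel. cis (- (\<xi> * x)) * f x)) * (LINT y|lborel. cis (\<xi> * y) * cnj (f y))))"
    unfolding cnj by (simp add: fourier_def c_def mult_ac)
  also have "\<dots> = (c * c) * (LINT \<xi>|lborel. (e \<xi> * (LINT x|lborel. cis (- (\<xi> * x)) * f x)) * (LINT y|lborel. cis (\<xi> * y) * cnj (f y)))"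
    by (rule integral_mult_right_zero)
  also have "(LINT \<xi>|lborel. (e \<xi> * (LINT x|lborel. cis (- (\<xi> * x)) * f x)) * (LINT y|lborel. cis (\<xi> * y) * cnj (f y)))
     = (LINT y|lborel. cnj (f y) * (LINT \<xi>|lborel. cis (\<xi> * y) * (e \<xi> * (LINT x|lborel. cis (- (\<xi> * x)) * f x))))"
    by (rule lborel_Fubini_kernel[OF efi _ km(1)]) (use fi in auto)
  also have "\<dots> = (LINT y|lborel. (2 * pi) * (cnj (f y) * (LINT z|lborel. f (y - \<epsilon> * z) * std_normal_density z)))"
    unfolding inner by (simp add: mult_ac)
  also have "\<dots> = (2 * pi) * (LINT y|lborel. cnj (f y) * (LINT z|lborel. f (y - \<epsilon> * z) * std_normal_density z))"
    by (rule integral_mult_right_zero)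
  finally show ?thesis unfolding cc by simp
qed

text \<open>The regularisation is removed along \<epsilon> = 1 / (n + 1): monotone convergence on
  the frequency side, dominated convergence on the physical side. The nonnegative integral makes the
  statement include square integrability of the transform.\<close>

lemma plancherel:
  fixes f :: "real \<Rightarrow> complex"
  assumes f: "quad_decay f"
  shows "(\<integral>\<^sup>+\<xi>. ennreal ((cmod (fourier f \<xi>))\<^sup>2) \<partial>lborel) = ennreal ((L2norm f)\<^sup>2)"
proof -
  note [measurable] = quad_decay_measurable[OF f] fourier_measurable[OF f]
  define \<epsilon> where "\<epsilon> = (\<lambda>n. 1 / real (Suc n))"
  have \<epsilon>: "\<epsilon> n > 0" "\<epsilon> n \<noteq> 0" for n by (simp_all add: \<epsilon>_def)
  have \<epsilon>0: "\<epsilon> \<longlonglongrightarrow> 0" unfolding \<epsilon>_def by (rule LIMSEQ_Suc[OF lim_1_over_n])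
  obtain K where K: "K \<ge> 0" "\<And>x. cmod (f x) \<le> K" using quad_decayE[OF f] by metis
  have fi: "integrable lborel f" by (rule quad_decay_integrable[OF f])
  have fc: "isCont f x" for x
    using quad_decay_continuous[OF f] by (simp add: continuous_on_eq_continuous_at)
  have ni: "integrable lborel std_normal_density" by (simp add: integrable_normal_density)
  define P where "P = (\<lambda>n y. LINT z|lborel. f (y - \<epsilon> n * z) * std_normal_density z)"
  have Pm: "P n \<in> borel_measurable borel" for n unfolding P_def by measurable
  have le: "cmod (f (y - \<epsilon> n * z) * std_normal_density z) \<le> K * std_normal_density z" for n y z
    unfolding norm_mult using K by (intro mult_mono) auto
  have P_bound: "cmod (P n y) \<le> K" for n y
  proof -
    have "cmod (P n y) \<le> (LINT z|lborel. cmod (f (y - \<epsilon> n * z) * std_normal_density z))"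
      unfolding P_def by (rule integral_norm_bound)
    also have "\<dots> \<le> (LINT z|lborel. K * std_normal_density z)"
    proof (rule integral_mono[OF _ _ le])
      show "integrable lborel (\<lambda>z. cmod (f (y - \<epsilon> n * z) * std_normal_density z))"
        by (rule Bochner_Integration.integrable_bound[OF integrable_mult_right[OF ni, of K]])
           (use le in \<open>auto intro!: AE_I2 order_trans[OF _ abs_ge_self]\<close>)
    qed (intro integrable_mult_right ni)
    also have "\<dots> = K" by (simp add: integral_normal_density)
    finally show ?thesis .
  qed
  have P_lim: "(\<lambda>n. P n y) \<longlonglongrightarrow> f y" for y
  proof -
    have "(\<lambda>n. P n y) \<longlonglongrightarrow> (LINT z|lborel. f y * std_normal_density z)"
      unfolding P_def
    proof (rule integral_dominated_convergence[where w = "\<lambda>z. K * std_normal_density z"])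
      show "AE z in lborel. (\<lambda>n. f (y - \<epsilon> n * z) * std_normal_density z) \<longlonglongrightarrow> f y * std_normal_density z"
      proof (rule AE_I2)
        fix z
        have "(\<lambda>n. y - \<epsilon> n * z) \<longlonglongrightarrow> y - 0 * z" by (intro tendsto_intros \<epsilon>0)
        then have "(\<lambda>n. f (y - \<epsilon> n * z)) \<longlonglongrightarrow> f y"
          by (intro isCont_tendsto_compose[OF fc]) simp
        then show "(\<lambda>n. f (y - \<epsilon> n * z) * std_normal_density z) \<longlonglongrightarrow> f y * std_normal_density z"
          by (intro tendsto_intros)
      qed
    qed (use le ni in auto)
    also have "(LINT z|lborel. f y * std_normal_density z) = f y * complex_of_real (LINT z|lborel. std_normal_density z)"
      by (subst integral_mult_right_zero) (simp only: integral_complex_of_real)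
    finally show ?thesis by (simp add: integral_normal_density)
  qed
  note [measurable] = Pm quad_decay_measurable[OF quad_decay_cnj[OF f]]
  have J: "(\<lambda>n. LINT y|lborel. cnj (f y) * P n y) \<longlonglongrightarrow> (LINT y|lborel. cnj (f y) * f y)"
  proof (rule integral_dominated_convergence[where w = "\<lambda>y. K * cmod (f y)"])
    show "AE y in lborel. (\<lambda>n. cnj (f y) * P n y) \<longlonglongrightarrow> cnj (f y) * f y"
      by (intro AE_I2 tendsto_intros P_lim)
    show "AE y in lborel. cmod (cnj (f y) * P n y) \<le> K * cmod (f y)" for n
      using mult_left_mono[OF P_bound norm_ge_zero] by (intro AE_I2) (simp add: norm_mult mult.commute)
    show "integrable lborel (\<lambda>y. K * cmod (f y))"
      by (intro integrable_mult_right integrable_norm fi)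
  qed measurable
  define h where "h = (\<lambda>n \<xi>. exp (- (\<epsilon> n * \<xi>)\<^sup>2 / 2) * (cmod (fourier f \<xi>))\<^sup>2)"
  have "complex_of_real (LINT \<xi>|lborel. h n \<xi>) = (LINT y|lborel. cnj (f y) * P n y)" for n
    unfolding h_def P_def by (rule gaussian_regularised_plancherel[OF f \<epsilon>(1)])
  moreover have "(LINT y|lborel. cnj (f y) * f y) = complex_of_real ((L2norm f)\<^sup>2)"
    unfolding L2norm_sq integral_complex_of_real[symmetric] complex_norm_square by (simp add: mult.commute)
  ultimately have "(\<lambda>n. complex_of_real (LINT \<xi>|lborel. h n \<xi>)) \<longlonglongrightarrow> complex_of_real ((L2norm f)\<^sup>2)"
    using J by simp
  then have R: "(\<lambda>n. LINT \<xi>|lborel. h n \<xi>) \<longlonglongrightarrow> (L2norm f)\<^sup>2"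
    by (simp only: tendsto_of_real_iff)
  have hi: "integrable lborel (h n)" for n
  proof -
    define B where "B = 1 / sqrt (2 * pi) * (LINT x|lborel. cmod (f x))"
    have B: "cmod (fourier f \<xi>) \<le> B" for \<xi> unfolding B_def by (rule fourier_bounded[OF f])
    have "(cmod (fourier f \<xi>))\<^sup>2 \<le> B\<^sup>2" for \<xi> by (intro power_mono B) auto
    then show ?thesis
      unfolding h_def
      by (intro Bochner_Integration.integrable_bound[OF integrable_mult_left[OF gaussian_integrable[OF \<epsilon>(2)[of n]], of "B\<^sup>2"]])
         (auto simp: abs_mult intro!: AE_I2 mult_left_mono)
  qed
  have hn: "(\<integral>\<^sup>+\<xi>. ennreal (h n \<xi>) \<partial>lborel) = ennreal (LINT \<xi>|lborel. h n \<xi>)" for n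
    by (rule nn_integral_eq_integral[OF hi]) (auto simp: h_def)
  have "(\<lambda>n. \<integral>\<^sup>+\<xi>. ennreal (h n \<xi>) \<partial>lborel) \<longlonglongrightarrow> (\<integral>\<^sup>+\<xi>. ennreal ((cmod (fourier f \<xi>))\<^sup>2) \<partial>lborel)"
  proof (rule nn_integral_LIMSEQ)
    show "incseq (\<lambda>n \<xi>. ennreal (h n \<xi>))"
    proof (intro incseq_SucI le_funI ennreal_leI)
      fix n \<xi>
      have "\<bar>\<epsilon> (Suc n) * \<xi>\<bar> \<le> \<bar>\<epsilon> n * \<xi>\<bar>"
        unfolding abs_mult by (intro mult_right_mono) (auto simp: \<epsilon>_def frac_le)
      then have "(\<epsilon> (Suc n) * \<xi>)\<^sup>2 \<le> (\<epsilon> n * \<xi>)\<^sup>2" by (simp only: abs_le_square_iff)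
      then show "h n \<xi> \<le> h (Suc n) \<xi>" unfolding h_def by (intro mult_right_mono) auto
    qed
    show "(\<lambda>n. ennreal (h n \<xi>)) \<longlonglongrightarrow> ennreal ((cmod (fourier f \<xi>))\<^sup>2)" for \<xi>
    proof (rule tendsto_ennrealI)
      have "(\<lambda>n. h n \<xi>) \<longlonglongrightarrow> exp (- (0 * \<xi>)\<^sup>2 / 2) * (cmod (fourier f \<xi>))\<^sup>2"
        unfolding h_def by (intro tendsto_intros \<epsilon>0) simp
      then show "(\<lambda>n. h n \<xi>) \<longlonglongrightarrow> (cmod (fourier f \<xi>))\<^sup>2" by simp
    qed
  qed (simp add: h_def)
  moreover have "(\<lambda>n. \<integral>\<^sup>+\<xi>. ennreal (h n \<xi>) \<partial>lborel) \<longlonglongrightarrow> ennreal ((L2norm f)\<^sup>2)"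
    unfolding hn by (rule tendsto_ennrealI[OF R])
  ultimately show ?thesis by (rule LIMSEQ_unique)
qed

text \<open>The resolvent multiplier has squared modulus 1 / (m^2 + \<xi>^2). With m = 2 \<kappa>
  the left side is the squared norm with exponent -1, which links the physical energy to the norm in
  question.\<close>

lemma resolvent_energy_fourier:
  fixes g :: "real \<Rightarrow> complex"
  assumes "m > 0" "quad_decay g"
  shows "(\<integral>\<^sup>+\<xi>. ennreal (1 / (m\<^sup>2 + \<xi>\<^sup>2) * (cmod (fourier g \<xi>))\<^sup>2) \<partial>lborel) = ennreal ((L2norm (resolvent m g))\<^sup>2)"
proof -
  have "1 / (m\<^sup>2 + \<xi>\<^sup>2) * (cmod (fourier g \<xi>))\<^sup>2 = (cmod (fourier (resolvent m g) \<xi>))\<^sup>2" for \<xi>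
  proof -
    have "m\<^sup>2 + \<xi>\<^sup>2 > 0" using assms(1) by (simp add: add_pos_nonneg)
    moreover have "(cmod (m - \<i> * \<xi>))\<^sup>2 = m\<^sup>2 + \<xi>\<^sup>2" by (simp add: cmod_power2)
    ultimately show ?thesis
      unfolding fourier_resolvent[OF assms, symmetric] norm_mult power_mult_distrib using assms(1) by simp
  qed
  then show ?thesis using plancherel[OF quad_decay_resolvent[OF assms]] by simp
qed

lemma fourier_integrable_sq:
  assumes "quad_decay f"
  shows "integrable lborel (\<lambda>\<xi>. (cmod (fourier f \<xi>))\<^sup>2)"
proof (rule integrableI_bounded)
  note [measurable] = fourier_measurable[OF assms]
  show "(\<lambda>\<xi>. (cmod (fourier f \<xi>))\<^sup>2) \<in> borel_measurable lborel" by measurable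
qed (simp add: plancherel[OF assms])

text \<open>For these parameters the weight is at most 1, so the integrand is integrable and the
  Bochner integral in \<open>Hnorm\<close> is not the default value 0.\<close>

lemma Hnorm_sq_nn_integral:
  assumes f: "quad_decay f" and "\<kappa> \<ge> 1" "\<sigma> \<le> 0"
  shows "ennreal ((Hnorm \<kappa> \<sigma> f)\<^sup>2) = (\<integral>\<^sup>+\<xi>. ennreal ((4 * \<kappa>\<^sup>2 + \<xi>\<^sup>2) powr \<sigma> * (cmod (fourier f \<xi>))\<^sup>2) \<partial>lborel)"
proof -
  note [measurable] = fourier_measurable[OF f]
  have "1 \<le> \<kappa>\<^sup>2" using assms(2) by (simp add: one_le_power)
  then have *: "1 \<le> 4 * \<kappa>\<^sup>2 + \<xi>\<^sup>2" for \<xi> :: real by (simp add: add_increasing2)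
  have w: "(4 * \<kappa>\<^sup>2 + \<xi>\<^sup>2) powr \<sigma> \<le> 1" for \<xi> :: real
    using powr_mono[OF assms(3) *[of \<xi>]] *[of \<xi>] by simp
  have i: "integrable lborel (\<lambda>\<xi>. (4 * \<kappa>\<^sup>2 + \<xi>\<^sup>2) powr \<sigma> * (cmod (fourier f \<xi>))\<^sup>2)"
    by (rule Bochner_Integration.integrable_bound[OF fourier_integrable_sq[OF f]])
       (auto simp: abs_mult w intro!: AE_I2 mult_left_le_one_le)
  have "(Hnorm \<kappa> \<sigma> f)\<^sup>2 = (LINT \<xi>|lborel. (4 * \<kappa>\<^sup>2 + \<xi>\<^sup>2) powr \<sigma> * (cmod (fourier f \<xi>))\<^sup>2)"
    by (simp add: Hnorm_def integral_nonneg_AE)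
  then show ?thesis by (simp add: nn_integral_eq_integral[OF i])
qed

section \<open>Subordination to the case \<open>\<sigma> = 0\<close>\<close>

text \<open>For 0 < \<sigma> < p this is the Beta function at (\<sigma>, p - \<sigma>). Only its
  positivity and finiteness matter below.\<close>

definition beta_mass :: "real \<Rightarrow> real \<Rightarrow> ennreal" where
  "beta_mass \<sigma> p = (\<integral>\<^sup>+r. indicator {0<..} r * ennreal (r powr (\<sigma> - 1) * (1 + r) powr (- p)) \<partial>lborel)"

text \<open>Scaling s = b r. The exponent p = 1 produces the Sobolev weight out of resolvent
  energies; p = 1/2 integrates the error term, which is proportional to 1 / m.\<close>

lemma subordination:
  assumes "b > 0"
  shows "(\<integral>\<^sup>+s. indicator {0<..} s * ennreal (s powr (\<sigma> - 1) * (b + s) powr (- p)) \<partial>lborel)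
    = ennreal (b powr (\<sigma> - p)) * beta_mass \<sigma> p"
proof -
  let ?f = "\<lambda>s. indicator {0<..} s * ennreal (s powr (\<sigma> - 1) * (b + s) powr (- p))"
  have *: "?f (0 + b * r) = ennreal (b powr (\<sigma> - p) / b) * (indicator {0<..} r * ennreal (r powr (\<sigma> - 1) * (1 + r) powr (- p)))" for r
  proof (cases "r > 0")
    case True
    have "b + b * r = b * (1 + r)" by (simp add: algebra_simps)
    then have "(b * r) powr (\<sigma> - 1) * (b + b * r) powr (- p)
        = (b powr (\<sigma> - 1) * b powr (- p)) * (r powr (\<sigma> - 1) * (1 + r) powr (- p))"
      using assms True by (simp add: powr_mult)
    also have "b powr (\<sigma> - 1) * b powr (- p) = b powr (\<sigma> - p) / b"
      using assms by (simp add: powr_diff powr_minus field_simps)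
    finally show ?thesis using assms True by (simp flip: ennreal_mult)
  next
    case False
    then show ?thesis using assms by (simp add: zero_less_mult_iff)
  qed
  have "(\<integral>\<^sup>+s. ?f s \<partial>lborel) = ennreal \<bar>b\<bar> * (\<integral>\<^sup>+r. ?f (0 + b * r) \<partial>lborel)"
    by (rule nn_integral_real_affine) (use assms in auto)
  also have "\<dots> = ennreal b * (ennreal (b powr (\<sigma> - p) / b) * beta_mass \<sigma> p)"
    unfolding * beta_mass_def using assms by (subst nn_integral_cmult) auto
  also have "\<dots> = ennreal (b powr (\<sigma> - p)) * beta_mass \<sigma> p"
    using assms by (simp flip: mult.assoc ennreal_mult)
  finally show ?thesis .
qed

lemma nn_integral_powr_finite:
  fixes e :: real
  shows "e > -1 \<Longrightarrow> (\<integral>\<^sup>+r. ennreal (indicator {0..1} r * r powr e) \<partial>lborel) < \<infinity>"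
    and "e < -1 \<Longrightarrow> (\<integral>\<^sup>+r. ennreal (indicator {1..} r * r powr e) \<partial>lborel) < \<infinity>"
proof -
  show "(\<integral>\<^sup>+r. ennreal (indicator {0..1} r * r powr e) \<partial>lborel) < \<infinity>" if "e > -1"
    using nn_integral_has_integral_lebesgue[OF _ has_integral_powr_from_0[OF that, of 1]]
    by (simp add: nn_integral_completion mult.commute)
  show "(\<integral>\<^sup>+r. ennreal (indicator {1..} r * r powr e) \<partial>lborel) < \<infinity>" if "e < -1"
    using nn_integral_has_integral_lebesgue[OF _ has_integral_powr_to_inf[OF that, of 1]]
    by (simp add: nn_integral_completion mult.commute)
qed

text \<open>Convergence at 0 uses \<sigma> > 0 and convergence at infinity uses \<sigma> < p. With p
  = 1/2 this is the point where the restriction \<sigma> < 1/2 is needed.\<close>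

lemma beta_mass_finite:
  assumes "0 < \<sigma>" "\<sigma> < p"
  shows "beta_mass \<sigma> p < \<infinity>"
proof -
  have "beta_mass \<sigma> p \<le> (\<integral>\<^sup>+r. ennreal (indicator {0..1} r * r powr (\<sigma> - 1)) + ennreal (indicator {1..} r * r powr (\<sigma> - 1 - p)) \<partial>lborel)"
    unfolding beta_mass_def
  proof (rule nn_integral_mono)
    fix r :: real
    consider "r \<le> 0" | "0 < r" "r \<le> 1" | "1 < r" by linarith
    then show "indicator {0<..} r * ennreal (r powr (\<sigma> - 1) * (1 + r) powr (- p))
        \<le> ennreal (indicator {0..1} r * r powr (\<sigma> - 1)) + ennreal (indicator {1..} r * r powr (\<sigma> - 1 - p))"
    proof cases
      case 2
      have "(1 + r) powr (- p) \<le> (1 + r) powr 0" using 2 assms by (intro powr_mono) auto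
      then have "r powr (\<sigma> - 1) * (1 + r) powr (- p) \<le> r powr (\<sigma> - 1)"
        using 2 by (intro mult_left_le) auto
      then have "ennreal (r powr (\<sigma> - 1) * (1 + r) powr (- p)) \<le> ennreal (r powr (\<sigma> - 1)) + 0"
        by (simp add: ennreal_leI)
      also have "\<dots> \<le> ennreal (r powr (\<sigma> - 1)) + ennreal (indicator {1..} r * r powr (\<sigma> - 1 - p))"
        by (intro add_left_mono) simp
      finally show ?thesis using 2 by simp
    next
      case 3
      have "(1 + r) powr (- p) \<le> r powr (- p)" using 3 assms by (intro powr_mono2') auto
      then have "r powr (\<sigma> - 1) * (1 + r) powr (- p) \<le> r powr (\<sigma> - 1) * r powr (- p)"
        by (intro mult_left_mono) auto
      also have "\<dots> = r powr (\<sigma> - 1 - p)" using 3 by (simp flip: powr_add)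
      finally show ?thesis using 3 by (simp add: ennreal_leI)
    qed simp
  qed
  also have "\<dots> < \<infinity>"
    using nn_integral_powr_finite(1)[of "\<sigma> - 1"] nn_integral_powr_finite(2)[of "\<sigma> - 1 - p"] assms
    by (subst nn_integral_add) auto
  finally show ?thesis .
qed

lemma beta_mass_pos: "beta_mass \<sigma> p \<noteq> 0"
proof
  assume "beta_mass \<sigma> p = 0"
  then have "AE r in lborel. indicator {0<..} r * ennreal (r powr (\<sigma> - 1) * (1 + r) powr (- p)) = 0"
    unfolding beta_mass_def by (subst (asm) nn_integral_0_iff_AE) auto
  then have "AE r in lborel. r \<notin> {0<..<1::real}"
    by eventually_elim (auto simp: indicator_def split: if_splits)
  moreover have "{r \<in> space lborel. \<not> r \<notin> {0<..<1::real}} = {0<..<1}" by auto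
  ultimately have "emeasure lborel {0<..<1::real} = 0"
    using AE_iff_measurable[of "{0<..<1::real}" lborel] by simp
  then show False by simp
qed

text \<open>The hypothesis at m = sqrt (4 \<kappa>^2 + s), which is at least 2, is integrated
  against s^(\<sigma> - 1) over s > 0 and divided by \<open>beta_mass \<sigma> 1\<close>. The
  summand 1 in the constant serves \<sigma> = 0, where the Beta integrals diverge and the hypothesis
  at m = 2 \<kappa> gives the claim directly.\<close>

lemma energy_comparison:
  fixes f g :: "real \<Rightarrow> complex"
  assumes f: "quad_decay f" and g: "quad_decay g" and \<sigma>: "0 \<le> \<sigma>" "\<sigma> < 1 / 2" and "\<kappa> \<ge> 1" "E \<ge> 0"
    and le: "\<And>m. m \<ge> 2 \<Longrightarrow> (L2norm (resolvent m f))\<^sup>2 \<le> (L2norm (resolvent m g))\<^sup>2 + E / m"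
  shows "(Hnorm \<kappa> (\<sigma> - 1) f)\<^sup>2 \<le> (Hnorm \<kappa> (\<sigma> - 1) g)\<^sup>2
    + (1 + enn2real (beta_mass \<sigma> (1 / 2)) / enn2real (beta_mass \<sigma> 1)) * E * \<kappa> powr (2 * \<sigma> - 1)"
proof -
  note [measurable] = fourier_measurable[OF f] fourier_measurable[OF g]
  have k0: "\<kappa> > 0" using assms by simp
  have sg: "\<sigma> - 1 \<le> 0" using \<sigma> by simp
  have pos: "4 * \<kappa>\<^sup>2 + \<xi>\<^sup>2 > 0" for \<xi> :: real using k0 by (intro add_pos_nonneg) auto
  show ?thesis
  proof (cases "\<sigma> = 0")
    case True
    have H: "(Hnorm \<kappa> (\<sigma> - 1) h)\<^sup>2 = (L2norm (resolvent (2 * \<kappa>) h))\<^sup>2" if h: "quad_decay h" for h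
    proof -
      have "(4 * \<kappa>\<^sup>2 + \<xi>\<^sup>2) powr (\<sigma> - 1) = 1 / ((2 * \<kappa>)\<^sup>2 + \<xi>\<^sup>2)" for \<xi> :: real
        using pos[of \<xi>] True by (simp add: powr_minus_divide)
      then have "ennreal ((Hnorm \<kappa> (\<sigma> - 1) h)\<^sup>2) = ennreal ((L2norm (resolvent (2 * \<kappa>) h))\<^sup>2)"
        using resolvent_energy_fourier[OF _ h, of "2 * \<kappa>"] k0
        unfolding Hnorm_sq_nn_integral[OF h assms(5) sg] by simp
      then show ?thesis by simp
    qed
    have "E / (2 * \<kappa>) \<le> E * \<kappa> powr (2 * \<sigma> - 1)"
      using True k0 assms(6) by (simp add: powr_minus_divide field_simps)
    also have "\<dots> \<le> (1 + enn2real (beta_mass \<sigma> (1 / 2)) / enn2real (beta_mass \<sigma> 1)) * (E * \<kappa> powr (2 * \<sigma> - 1))"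
      using mult_right_mono[of 1 "1 + enn2real (beta_mass \<sigma> (1 / 2)) / enn2real (beta_mass \<sigma> 1)"
          "E * \<kappa> powr (2 * \<sigma> - 1)"] assms(6) by simp
    finally show ?thesis
      unfolding H[OF f] H[OF g] using le[of "2 * \<kappa>"] assms(5) by (simp add: mult.assoc)
  next
    case False
    then have s0: "\<sigma> > 0" using \<sigma> by simp
    define c d where "c = beta_mass \<sigma> 1" and "d = beta_mass \<sigma> (1 / 2)"
    have c: "c < \<infinity>" "c \<noteq> 0" and d: "d < \<infinity>"
      using beta_mass_finite[of \<sigma>] beta_mass_pos s0 \<sigma> by (auto simp: c_def d_def)
    define w where "w = (\<lambda>s. indicator {0<..} s * ennreal (s powr (\<sigma> - 1)))"
    have [measurable]: "w \<in> borel_measurable borel" unfolding w_def by measurable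
    let ?F = "\<lambda>h \<xi>. ennreal ((cmod (fourier h \<xi>))\<^sup>2)"
    let ?k = "\<lambda>s \<xi>. ennreal ((4 * \<kappa>\<^sup>2 + \<xi>\<^sup>2 + s) powr (- 1))"
    \<comment> \<open>For fixed \<open>s\<close> the frequency integral is the resolvent energy at m
      = sqrt (4 \<kappa>^2 + s); for s \<le> 0 both sides vanish with \<open>w s\<close>.\<close>
    have slice: "w s * ennreal ((L2norm (resolvent (sqrt (4 * \<kappa>\<^sup>2 + s)) h))\<^sup>2)
        = (\<integral>\<^sup>+\<xi>. w s * ?k s \<xi> * ?F h \<xi> \<partial>lborel)" if h: "quad_decay h" for h and s :: real
    proof (cases "s > 0")
      case True
      note [measurable] = fourier_measurable[OF h]
      have p: "4 * \<kappa>\<^sup>2 + s > 0" using True by (simp add: add_nonneg_pos)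
      have eq: "w s * ?k s \<xi> * ?F h \<xi>
          = w s * ennreal (1 / ((sqrt (4 * \<kappa>\<^sup>2 + s))\<^sup>2 + \<xi>\<^sup>2) * (cmod (fourier h \<xi>))\<^sup>2)" for \<xi>
      proof -
        have "(4 * \<kappa>\<^sup>2 + \<xi>\<^sup>2 + s) powr (- 1) = 1 / ((sqrt (4 * \<kappa>\<^sup>2 + s))\<^sup>2 + \<xi>\<^sup>2)"
          using p True pos[of \<xi>] by (simp add: powr_minus_divide add_ac)
        then show ?thesis by (simp add: mult.assoc flip: ennreal_mult)
      qed
      have "(\<integral>\<^sup>+\<xi>. w s * ?k s \<xi> * ?F h \<xi> \<partial>lborel)
          = w s * (\<integral>\<^sup>+\<xi>. ennreal (1 / ((sqrt (4 * \<kappa>\<^sup>2 + s))\<^sup>2 + \<xi>\<^sup>2) * (cmod (fourier h \<xi>))\<^sup>2) \<partial>lborel)"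
        unfolding eq by (rule nn_integral_cmult) measurable
      also have "(\<integral>\<^sup>+\<xi>. ennreal (1 / ((sqrt (4 * \<kappa>\<^sup>2 + s))\<^sup>2 + \<xi>\<^sup>2) * (cmod (fourier h \<xi>))\<^sup>2) \<partial>lborel)
          = ennreal ((L2norm (resolvent (sqrt (4 * \<kappa>\<^sup>2 + s)) h))\<^sup>2)"
        by (rule resolvent_energy_fourier[OF _ h]) (use p in simp)
      finally show ?thesis ..
    qed (simp add: w_def)
    \<comment> \<open>Tonelli turns the subordination formula into a superposition of resolvent
      energies. Measurability of these energies in \<open>s\<close> is read off from their frequency
      integrals.\<close>
    have rep: "c * ennreal ((Hnorm \<kappa> (\<sigma> - 1) h)\<^sup>2)
        = (\<integral>\<^sup>+s. w s * ennreal ((L2norm (resolvent (sqrt (4 * \<kappa>\<^sup>2 + s)) h))\<^sup>2) \<partial>lborel)"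
      and meas: "(\<lambda>s. w s * ennreal ((L2norm (resolvent (sqrt (4 * \<kappa>\<^sup>2 + s)) h))\<^sup>2)) \<in> borel_measurable lborel"
      if h: "quad_decay h" for h
    proof -
      note [measurable] = fourier_measurable[OF h]
      show "(\<lambda>s. w s * ennreal ((L2norm (resolvent (sqrt (4 * \<kappa>\<^sup>2 + s)) h))\<^sup>2)) \<in> borel_measurable lborel"
        unfolding slice[OF h] by measurable
      have "c * ennreal ((Hnorm \<kappa> (\<sigma> - 1) h)\<^sup>2)
          = (\<integral>\<^sup>+\<xi>. c * ennreal ((4 * \<kappa>\<^sup>2 + \<xi>\<^sup>2) powr (\<sigma> - 1) * (cmod (fourier h \<xi>))\<^sup>2) \<partial>lborel)"
        unfolding Hnorm_sq_nn_integral[OF h assms(5) sg] by (rule nn_integral_cmult[symmetric]) measurable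
      also have "\<dots> = (\<integral>\<^sup>+\<xi>. (\<integral>\<^sup>+s. w s * ?k s \<xi> * ?F h \<xi> \<partial>lborel) \<partial>lborel)"
      proof (rule nn_integral_cong)
        fix \<xi>
        have "c * ennreal ((4 * \<kappa>\<^sup>2 + \<xi>\<^sup>2) powr (\<sigma> - 1) * (cmod (fourier h \<xi>))\<^sup>2)
            = (ennreal ((4 * \<kappa>\<^sup>2 + \<xi>\<^sup>2) powr (\<sigma> - 1)) * beta_mass \<sigma> 1) * ?F h \<xi>"
          by (simp add: c_def ennreal_mult mult_ac)
        also have "\<dots> = (\<integral>\<^sup>+s. w s * ?k s \<xi> \<partial>lborel) * ?F h \<xi>"
          unfolding subordination[OF pos, symmetric] w_def
          by (simp only: ennreal_mult[OF powr_ge_zero powr_ge_zero] mult.assoc)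
        also have "\<dots> = (\<integral>\<^sup>+s. w s * ?k s \<xi> * ?F h \<xi> \<partial>lborel)"
          by (rule nn_integral_multc[symmetric]) measurable
        finally show "c * ennreal ((4 * \<kappa>\<^sup>2 + \<xi>\<^sup>2) powr (\<sigma> - 1) * (cmod (fourier h \<xi>))\<^sup>2)
            = (\<integral>\<^sup>+s. w s * ?k s \<xi> * ?F h \<xi> \<partial>lborel)" .
      qed
      also have "\<dots> = (\<integral>\<^sup>+s. (\<integral>\<^sup>+\<xi>. w s * ?k s \<xi> * ?F h \<xi> \<partial>lborel) \<partial>lborel)"
        by (rule lborel_pair.Fubini') measurable
      finally show "c * ennreal ((Hnorm \<kappa> (\<sigma> - 1) h)\<^sup>2)
        = (\<integral>\<^sup>+s. w s * ennreal ((L2norm (resolvent (sqrt (4 * \<kappa>\<^sup>2 + s)) h))\<^sup>2) \<partial>lborel)"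
        unfolding slice[OF h] .
    qed
    have "c * ennreal ((Hnorm \<kappa> (\<sigma> - 1) f)\<^sup>2)
        \<le> (\<integral>\<^sup>+s. w s * ennreal ((L2norm (resolvent (sqrt (4 * \<kappa>\<^sup>2 + s)) g))\<^sup>2)
              + ennreal E * (indicator {0<..} s * ennreal (s powr (\<sigma> - 1) * (4 * \<kappa>\<^sup>2 + s) powr (- (1 / 2)))) \<partial>lborel)"
      unfolding rep[OF f]
    proof (rule nn_integral_mono)
      fix s :: real
      let ?m = "sqrt (4 * \<kappa>\<^sup>2 + s)"
      show "w s * ennreal ((L2norm (resolvent ?m f))\<^sup>2) \<le> w s * ennreal ((L2norm (resolvent ?m g))\<^sup>2)
         + ennreal E * (indicator {0<..} s * ennreal (s powr (\<sigma> - 1) * (4 * \<kappa>\<^sup>2 + s) powr (- (1 / 2))))"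
      proof (cases "s > 0")
        case True
        have p: "4 * \<kappa>\<^sup>2 + s > 0" using True by (simp add: add_nonneg_pos)
        have "1 \<le> \<kappa>\<^sup>2" using assms(5) by (simp add: one_le_power)
        then have "sqrt (2\<^sup>2) \<le> ?m" using True by (intro real_sqrt_le_mono) auto
        then have "?m \<ge> 2" by simp
        have "ennreal ((L2norm (resolvent ?m f))\<^sup>2) \<le> ennreal ((L2norm (resolvent ?m g))\<^sup>2 + E / ?m)"
          by (intro ennreal_leI le \<open>?m \<ge> 2\<close>)
        also have "E / ?m = E * (4 * \<kappa>\<^sup>2 + s) powr (- (1 / 2))"
          using p by (simp add: powr_minus_divide powr_half_sqrt)
        finally have "w s * ennreal ((L2norm (resolvent ?m f))\<^sup>2)
            \<le> w s * (ennreal ((L2norm (resolvent ?m g))\<^sup>2) + ennreal E * ennreal ((4 * \<kappa>\<^sup>2 + s) powr (- (1 / 2))))"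
          using assms(6) by (intro mult_left_mono) (simp_all add: ennreal_mult)
        then show ?thesis
          by (simp add: w_def ennreal_mult distrib_left mult_ac)
      qed (simp add: w_def)
    qed
    also have "\<dots> = c * ennreal ((Hnorm \<kappa> (\<sigma> - 1) g)\<^sup>2) + ennreal E * (ennreal ((4 * \<kappa>\<^sup>2) powr (\<sigma> - 1 / 2)) * d)"
    proof -
      have "(\<integral>\<^sup>+s. ennreal E * (indicator {0<..} s * ennreal (s powr (\<sigma> - 1) * (4 * \<kappa>\<^sup>2 + s) powr (- (1 / 2)))) \<partial>lborel)
          = ennreal E * (ennreal ((4 * \<kappa>\<^sup>2) powr (\<sigma> - 1 / 2)) * d)"
        unfolding d_def using k0 by (subst nn_integral_cmult) (auto simp: subordination)
      then show ?thesis
        unfolding rep[OF g] by (subst nn_integral_add[OF meas[OF g]]) auto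
    qed
    finally have le': "c * ennreal ((Hnorm \<kappa> (\<sigma> - 1) f)\<^sup>2)
        \<le> c * ennreal ((Hnorm \<kappa> (\<sigma> - 1) g)\<^sup>2) + ennreal E * (ennreal ((4 * \<kappa>\<^sup>2) powr (\<sigma> - 1 / 2)) * d)" .
    define c' d' where "c' = enn2real c" and "d' = enn2real d"
    have c': "c = ennreal c'" "c' > 0" and d': "d = ennreal d'" "d' \<ge> 0"
      using c d by (auto simp: c'_def d'_def less_top enn2real_positive_iff zero_less_iff_neq_zero)
    have "ennreal (c' * (Hnorm \<kappa> (\<sigma> - 1) f)\<^sup>2)
        \<le> ennreal (c' * (Hnorm \<kappa> (\<sigma> - 1) g)\<^sup>2 + E * ((4 * \<kappa>\<^sup>2) powr (\<sigma> - 1 / 2) * d'))"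
      using le' c' d' assms(6) by (simp add: ennreal_mult)
    then have 1: "c' * (Hnorm \<kappa> (\<sigma> - 1) f)\<^sup>2
        \<le> c' * (Hnorm \<kappa> (\<sigma> - 1) g)\<^sup>2 + E * ((4 * \<kappa>\<^sup>2) powr (\<sigma> - 1 / 2) * d')"
      using c' d' assms(6) by (subst (asm) ennreal_le_iff) auto
    \<comment> \<open>The exponent is negative, so dropping the factor 4 only increases the
      power.\<close>
    have "(4 * \<kappa>\<^sup>2) powr (\<sigma> - 1 / 2) \<le> (\<kappa>\<^sup>2) powr (\<sigma> - 1 / 2)"
      using k0 \<sigma> by (intro powr_mono2') auto
    also have "(\<kappa>\<^sup>2) powr (\<sigma> - 1 / 2) = \<kappa> powr (2 * \<sigma> - 1)"
    proof -
      have "(\<kappa> powr 2) powr (\<sigma> - 1 / 2) = \<kappa> powr (2 * \<sigma> - 1)"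
        by (simp add: powr_powr algebra_simps)
      then show ?thesis using k0 by simp
    qed
    finally have "E * ((4 * \<kappa>\<^sup>2) powr (\<sigma> - 1 / 2) * d') \<le> E * (\<kappa> powr (2 * \<sigma> - 1) * d')"
      using d' assms(6) by (intro mult_left_mono mult_right_mono) auto
    with 1 have "c' * (Hnorm \<kappa> (\<sigma> - 1) f)\<^sup>2
        \<le> c' * ((Hnorm \<kappa> (\<sigma> - 1) g)\<^sup>2 + d' / c' * E * \<kappa> powr (2 * \<sigma> - 1))"
      using c' by (simp add: distrib_left mult_ac)
    then have "(Hnorm \<kappa> (\<sigma> - 1) f)\<^sup>2 \<le> (Hnorm \<kappa> (\<sigma> - 1) g)\<^sup>2 + d' / c' * E * \<kappa> powr (2 * \<sigma> - 1)"
      using c' by (subst (asm) mult_le_cancel_left_pos) auto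
    also have "d' / c' * E * \<kappa> powr (2 * \<sigma> - 1) \<le> (1 + d' / c') * E * \<kappa> powr (2 * \<sigma> - 1)"
      using assms(6) by (intro mult_right_mono) auto
    finally show ?thesis by (simp add: c'_def d'_def c_def d_def)
  qed
qed

theorem proposition8p1:
  fixes \<sigma> :: real
  assumes "0 \<le> \<sigma>" and "\<sigma> < 1 / 2"
  shows "\<exists>\<delta>::real. \<delta> > 0 \<and> (\<exists>C::real. C > 0 \<and>
    (\<forall>q s. s \<in> {1, -1} \<longrightarrow> nls_solution s q \<or> mkdv_solution s q \<longrightarrow> L2norm (q 0) \<le> \<delta> \<longrightarrow>
      (\<forall>t \<kappa>. \<kappa> \<ge> 1 \<longrightarrow>
        (Hnorm \<kappa> (\<sigma> - 1) (xderiv (q t)))\<^sup>2 \<le>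
          C * ((Hnorm \<kappa> (\<sigma> - 1) (xderiv (q 0)))\<^sup>2
               + \<kappa> powr (2 * \<sigma> - 1) * \<delta>\<^sup>2 * (L2norm (q 0))\<^sup>2))))"
proof -
  define c where "c = 1 + enn2real (beta_mass \<sigma> (1 / 2)) / enn2real (beta_mass \<sigma> 1)"
  have c1: "c \<ge> 1" by (simp add: c_def)
  have main: "(Hnorm \<kappa> (\<sigma> - 1) (xderiv (q t)))\<^sup>2 \<le>
          (4 * c) * ((Hnorm \<kappa> (\<sigma> - 1) (xderiv (q 0)))\<^sup>2
               + \<kappa> powr (2 * \<sigma> - 1) * (1 / 2)\<^sup>2 * (L2norm (q 0))\<^sup>2)"
    if "s \<in> {1, - 1}" "nls_solution s q \<or> mkdv_solution s q" "L2norm (q 0) \<le> 1 / 2" "\<kappa> \<ge> 1" for q s t \<kappa>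
  proof -
    define N H where "N = L2norm (q 0)" and "H = (Hnorm \<kappa> (\<sigma> - 1) (xderiv (q 0)))\<^sup>2"
    have N: "0 \<le> N" "N \<le> 1 / 2" using that by (auto simp: N_def L2norm_def integral_nonneg_AE)
    have qd: "quad_decay (xderiv (q t))" for t
      using schwartz_quad_decay[OF solution_schwartz[OF that(2)], of 1] by simp
    have "(Hnorm \<kappa> (\<sigma> - 1) (xderiv (q t)))\<^sup>2 \<le> H + c * (4 * N ^ 4) * \<kappa> powr (2 * \<sigma> - 1)"
      unfolding H_def c_def
      by (rule energy_comparison[OF qd qd assms that(4)])
         (use solution_energy[OF that(1-3)] in \<open>auto simp: N_def\<close>)
    \<comment> \<open>Two of the four factors of \<open>N\<close> are traded for \<delta> = 1/2. The
      4 from the energy estimate remains and makes the final constant \<open>4 * c\<close>.\<close>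
    also have "c * (4 * N ^ 4) * \<kappa> powr (2 * \<sigma> - 1) \<le> c * (4 * ((1 / 2)\<^sup>2 * N\<^sup>2)) * \<kappa> powr (2 * \<sigma> - 1)"
    proof -
      have "N\<^sup>2 * N\<^sup>2 \<le> (1 / 2)\<^sup>2 * N\<^sup>2" using N by (intro mult_right_mono power_mono) auto
      then have "N ^ 4 \<le> (1 / 2)\<^sup>2 * N\<^sup>2" by (simp flip: power_add)
      then show ?thesis using c1 by (intro mult_right_mono mult_left_mono) auto
    qed
    also have "H \<le> (4 * c) * H" using mult_right_mono[of 1 "4 * c" H] c1 by (simp add: H_def)
    finally show ?thesis by (simp add: H_def N_def algebra_simps)
  qed
  show ?thesis
    by (intro exI[of _ "1 / 2"] exI[of _ "4 * c"] conjI allI impI main) (use c1 in auto)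
qed

end
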